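(* Let $\mathfrak n$ be an $m$-dimensional real $k$-step nilpotent Lie algebra with differential $d:\mathfrak n^*\to\Lambda^2\mathfrak n^*$, and let $\{E_r^{p,q}\}$ be the spectral sequence associated to $\mathfrak n$. Then: (1) $E_\infty^{k-1,1-k}=H^0(\mathfrak n)=\mathbb R$, and hence $E_\infty^{p,-p}=0$ for all $p=0,\ldots,k-2$. (2) $E_\infty^{k-1,2-k}=H^1(\mathfrak n)=\ker\big(d:\mathfrak n^*\to\Lambda^2\mathfrak n^*\big)$, and hence $E_\infty^{p,1-p}=0$ for all $p=0,\ldots,k-2$. (3) $E_\infty^{0,m-1}=H^{m-1}(\mathfrak n)$, and hence $E_\infty^{p,m-1-p}=0$ for all $p=1,\ldots,k-1$. (4) $E_\infty^{0,m}\simeq H^m(\mathfrak n)\simeq\mathbb R$, and hence $E_\infty^{p,m-p}=0$ for all $p=1,\ldots,k-1$.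
   Context: All Lie algebras are real, finite dimensional and nonzero. The central descending series of $\mathfrak n$ is $\mathfrak n^0=\mathfrak n$, $\mathfrak n^i=[\mathfrak n,\mathfrak n^{i-1}]$ for $i\ge1$; $\mathfrak n$ is $k$-step nilpotent if $\mathfrak n^k=0$ and $\mathfrak n^{k-1}\ne0$ (so nonzero abelian Lie algebras are 1-step nilpotent). The Chevalley-Eilenberg complex is $C^q=\Lambda^q\mathfrak n^*$ (with $C^0=\mathbb R$, $d=0$ on $C^0$), with differential $d:\Lambda^s\mathfrak n^*\to\Lambda^{s+1}\mathfrak n^*$, $dx(u_1,\ldots,u_{s+1})=\sum_{i<j}(-1)^{i+j-1}x([u_i,u_j],u_1,\ldots,\hat u_i,\ldots,\hat u_j,\ldots,u_{s+1})$. Its cohomology is $H^*(\mathfrak n)$. Set $V_i=0$ for $i\le0$ and $V_i=\{x\in\mathfrak n^*: dx\in\Lambda^2V_{i-1}\}$ for $i\ge1$. Then $V_i$ is the annihilator of $\mathfrak n^i$ for $i\ge 0$, and $V_i=\mathfrak n^*$ for $i\ge k$. Define a decreasing filtration of the complex $C^*$ by subcomplexes: $F^pC^q=\Lambda^qV_{k-p}$ for $p\le k-1$ (with $\Lambda^0V_{k-p}=\mathbb R$), and $F^pC^q=0$ for all $q$ if $p\ge k$; thus $F^pC^*=C^*$ for $p\le0$. The spectral sequence associated to $\mathfrak n$ is the cohomological spectral sequence $\{E_r^{p,q}\}$ ($r\ge0$, $p,q\in\mathbb Z$) of this filtered complex: with $A_r^{p,q}=\{x\in F^pC^{p+q}: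 dx\in F^{p+r}C^{p+q+1}\}$, $$E_r^{p,q}=\frac{A_r^{p,q}}{d(A_{r-1}^{p-r+1,q+r-2})+A_{r-1}^{p+1,q-1}},$$ and $d_r^{p,q}:E_r^{p,q}\to E_r^{p+r,q-r+1}$ is induced by $d$; in particular $E_0^{p,q}=F^pC^{p+q}/F^{p+1}C^{p+q}$. The filtration is bounded, and $E_\infty^{p,q}$ denotes the common value of $E_r^{p,q}$ for $r$ large. Equalities between limit terms and cohomology groups are understood via the natural identification of $E_\infty^{p,q}$ with the graded piece $F^pH^{p+q}(\mathfrak n)/F^{p+1}H^{p+q}(\mathfrak n)$ of the induced filtration. *)

theory Defs
  imports "HOL-Analysis.Analysis" "HOL-Library.Function_Algebras"
begin

instantiation "fun" :: (type, real_vector) real_vector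
begin

definition scaleR_fun :: "real \<Rightarrow> ('a \<Rightarrow> 'b) \<Rightarrow> 'a \<Rightarrow> 'b"
  where "scaleR_fun c f = (\<lambda>x. c *\<^sub>R f x)"

instance
  by standard (auto simp: scaleR_fun_def fun_eq_iff scaleR_add_right scaleR_add_left)

end

subsection \<open>Vector spaces with explicit carrier, and their quotients\<close>

text \<open>
  Quotients, and quotients of subspaces of quotients, do not live on a type of their own, so the
  operations are part of a record.  For a subspace \<open>W\<close>, the quotient of \<open>V\<close> by \<open>W\<close> consists of the
  cosets of \<open>W\<close>.  The summand \<open>w\<close> in the scalar multiplication makes \<open>0 \<cdot> X\<close> the coset \<open>W\<close>.
\<close>

record 'v vspace =
  vs_carrier :: "'v set"
  vs_add :: "'v \<Rightarrow> 'v \<Rightarrow> 'v"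
  vs_scale :: "real \<Rightarrow> 'v \<Rightarrow> 'v"
  vs_zero :: 'v

definition vs_of :: "'v::real_vector set \<Rightarrow> 'v vspace"
  where "vs_of S = \<lparr>vs_carrier = S, vs_add = (+), vs_scale = (*\<^sub>R), vs_zero = 0\<rparr>"

definition vs_coset :: "'v vspace \<Rightarrow> 'v set \<Rightarrow> 'v \<Rightarrow> 'v set"
  where "vs_coset V W x = {vs_add V x w | w. w \<in> W}"

definition vs_quot :: "'v vspace \<Rightarrow> 'v set \<Rightarrow> 'v set vspace"
  where "vs_quot V W =
    \<lparr>vs_carrier = vs_coset V W ` vs_carrier V,
     vs_add = (\<lambda>X Y. {vs_add V x y | x y. x \<in> X \<and> y \<in> Y}),
     vs_scale = (\<lambda>c X. {vs_add V (vs_scale V c x) w | x w. x \<in> X \<and> w \<in> W}),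
     vs_zero = W\<rparr>"

definition vs_iso :: "'v vspace \<Rightarrow> 'w vspace \<Rightarrow> ('v \<Rightarrow> 'w) \<Rightarrow> bool"
  where "vs_iso V W f \<longleftrightarrow>
    bij_betw f (vs_carrier V) (vs_carrier W) \<and>
    (\<forall>x\<in>vs_carrier V. \<forall>y\<in>vs_carrier V. f (vs_add V x y) = vs_add W (f x) (f y)) \<and>
    (\<forall>c. \<forall>x\<in>vs_carrier V. f (vs_scale V c x) = vs_scale W c (f x))"

definition vs_isomorphic :: "'v vspace \<Rightarrow> 'w vspace \<Rightarrow> bool"
  where "vs_isomorphic V W \<longleftrightarrow> (\<exists>f. vs_iso V W f)"

definition vs_is_zero :: "'v vspace \<Rightarrow> bool"
  where "vs_is_zero V \<longleftrightarrow> vs_carrier V = {vs_zero V}"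

subsection \<open>Nilpotent Lie algebras\<close>

locale real_lie_algebra =
  fixes br :: "'n::real_vector \<Rightarrow> 'n \<Rightarrow> 'n"
  assumes bilinear: "bilinear br"
    and alternating: "br x x = 0"
    and jacobi: "br x (br y z) + br y (br z x) + br z (br x y) = 0"
    and finite_dimensional: "\<exists>B::'n set. finite B \<and> span B = UNIV"
    and nonzero: "\<exists>x::'n. x \<noteq> 0"

primrec descending_series :: "('n::real_vector \<Rightarrow> 'n \<Rightarrow> 'n) \<Rightarrow> nat \<Rightarrow> 'n set"
  where
    "descending_series br 0 = UNIV"
  | "descending_series br (Suc i) = span {br x y | x y. y \<in> descending_series br i}"

definition step_nilpotent :: "('n::real_vector \<Rightarrow> 'n \<Rightarrow> 'n) \<Rightarrow> nat \<Rightarrow> bool"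
  where "step_nilpotent br k \<longleftrightarrow>
    1 \<le> k \<and> descending_series br k = {0} \<and> descending_series br (k - 1) \<noteq> {0}"

subsection \<open>The Chevalley--Eilenberg complex\<close>

text \<open>
  A \<open>q\<close>-form is an alternating multilinear function of the entries of a list of length \<open>q\<close>, extended
  by zero to lists of other lengths.  \<open>\<Lambda>\<^sup>q V\<close>, for a space \<open>V\<close> of linear functionals, is the span of
  the products of \<open>q\<close> elements of \<open>V\<close>; it is zero for \<open>q < 0\<close>, and for \<open>q = 0\<close> it is spanned by
  \<open>wedge []\<close>, the form \<open>1\<close>.  A functional \<open>x\<close> becomes the 1-form \<open>wedge [x]\<close>.
\<close>

type_synonym 'n form = "'n list \<Rightarrow> real"

definition wedge :: "('n \<Rightarrow> real) list \<Rightarrow> 'n form"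
  where "wedge xs us =
    (if length us = length xs
     then \<Sum>\<sigma> | \<sigma> permutes {..<length xs}.
            of_int (sign \<sigma>) * (\<Prod>i<length xs. (xs ! i) (us ! \<sigma> i))
     else 0)"

definition ext_power :: "int \<Rightarrow> ('n \<Rightarrow> real) set \<Rightarrow> 'n form set"
  where "ext_power q V =
    (if q < 0 then {0} else span {wedge xs | xs. int (length xs) = q \<and> set xs \<subseteq> V})"

definition cochains :: "int \<Rightarrow> 'n::real_vector form set"
  where "cochains q = ext_power q {x. linear x}"

text \<open>
  With positions counted from 0, the sign \<open>(-1)\<^sup>i\<^sup>+\<^sup>j\<^sup>-\<^sup>1\<close> of the definition by positions counted from 1
  becomes \<open>(-1)\<^sup>i\<^sup>+\<^sup>j\<^sup>+\<^sup>1\<close>.  On lists of length at most 1 the sum is empty, so \<open>d = 0\<close> on \<open>C\<^sup>0\<close>.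
\<close>

definition ce_diff :: "('n \<Rightarrow> 'n \<Rightarrow> 'n) \<Rightarrow> 'n form \<Rightarrow> 'n form"
  where "ce_diff br x us =
    (\<Sum>(i, j) | i < j \<and> j < length us.
       (- 1) ^ (i + j + 1) * x (br (us ! i) (us ! j) # nths us (- {i, j})))"

definition ker_d :: "('n::real_vector \<Rightarrow> 'n \<Rightarrow> 'n) \<Rightarrow> ('n \<Rightarrow> real) set"
  where "ker_d br = {x. linear x \<and> ce_diff br (wedge [x]) = 0}"

definition cocycles :: "('n::real_vector \<Rightarrow> 'n \<Rightarrow> 'n) \<Rightarrow> int \<Rightarrow> 'n form set"
  where "cocycles br n = {x \<in> cochains n. ce_diff br x = 0}"

definition coboundaries :: "('n::real_vector \<Rightarrow> 'n \<Rightarrow> 'n) \<Rightarrow> int \<Rightarrow> 'n form set"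
  where "coboundaries br n = ce_diff br ` cochains (n - 1)"

definition cohomology :: "('n::real_vector \<Rightarrow> 'n \<Rightarrow> 'n) \<Rightarrow> int \<Rightarrow> 'n form set vspace"
  where "cohomology br n = vs_quot (vs_of (cocycles br n)) (coboundaries br n)"

definition cohomology_class ::
    "('n::real_vector \<Rightarrow> 'n \<Rightarrow> 'n) \<Rightarrow> int \<Rightarrow> 'n form \<Rightarrow> 'n form set"
  where "cohomology_class br n x = vs_coset (vs_of (cocycles br n)) (coboundaries br n) x"

subsection \<open>The filtration and its spectral sequence\<close>

primrec V_space :: "('n::real_vector \<Rightarrow> 'n \<Rightarrow> 'n) \<Rightarrow> nat \<Rightarrow> ('n \<Rightarrow> real) set"
  where
    "V_space br 0 = {0}"
  | "V_space br (Suc i) = {x. linear x \<and> ce_diff br (wedge [x]) \<in> ext_power 2 (V_space br i)}"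

text \<open>\<open>filtr br k p q\<close> is \<open>F\<^sup>p C\<^sup>q\<close>; the nilpotency step \<open>k\<close> enters the filtration.\<close>

definition filtr :: "('n::real_vector \<Rightarrow> 'n \<Rightarrow> 'n) \<Rightarrow> nat \<Rightarrow> int \<Rightarrow> int \<Rightarrow> 'n form set"
  where "filtr br k p q =
    (if p \<le> int k - 1 then ext_power q (V_space br (nat (int k - p))) else {0})"

text \<open>The index \<open>r\<close> is an integer because \<open>E\<^sub>0\<close> refers to \<open>A\<^sub>r\<close> with \<open>r = -1\<close>.\<close>

definition ss_A :: "('n::real_vector \<Rightarrow> 'n \<Rightarrow> 'n) \<Rightarrow> nat \<Rightarrow> int \<Rightarrow> int \<Rightarrow> int \<Rightarrow> 'n form set"
  where "ss_A br k r p q =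
    {x \<in> filtr br k p (p + q). ce_diff br x \<in> filtr br k (p + r) (p + q + 1)}"

definition ss_E ::
    "('n::real_vector \<Rightarrow> 'n \<Rightarrow> 'n) \<Rightarrow> nat \<Rightarrow> nat \<Rightarrow> int \<Rightarrow> int \<Rightarrow> 'n form set vspace"
  where "ss_E br k r p q =
    vs_quot (vs_of (ss_A br k (int r) p q))
      {ce_diff br y + z | y z.
         y \<in> ss_A br k (int r - 1) (p - int r + 1) (q + int r - 2) \<and>
         z \<in> ss_A br k (int r - 1) (p + 1) (q - 1)}"

text \<open>
  Numerator and denominator of \<open>E\<^sub>r\<^sup>p\<^sup>,\<^sup>q\<close> are the same subspaces of the complex for all large \<open>r\<close>, so the
  common value is meant literally.
\<close>

definition ss_E_inf ::
    "('n::real_vector \<Rightarrow> 'n \<Rightarrow> 'n) \<Rightarrow> nat \<Rightarrow> int \<Rightarrow> int \<Rightarrow> 'n form set vspace"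
  where "ss_E_inf br k p q = (THE E. \<exists>r0. \<forall>r\<ge>r0. ss_E br k r p q = E)"

subsection \<open>Limit terms and cohomology\<close>

text \<open>\<open>filtr_H br k p n\<close> is \<open>F\<^sup>p H\<^sup>n\<close>, and \<open>graded_H br k p n\<close> is \<open>F\<^sup>p H\<^sup>n / F\<^sup>p\<^sup>+\<^sup>1 H\<^sup>n\<close>.\<close>

definition filtr_H ::
    "('n::real_vector \<Rightarrow> 'n \<Rightarrow> 'n) \<Rightarrow> nat \<Rightarrow> int \<Rightarrow> int \<Rightarrow> 'n form set set"
  where "filtr_H br k p n = cohomology_class br n ` (cocycles br n \<inter> filtr br k p n)"

definition graded_H ::
    "('n::real_vector \<Rightarrow> 'n \<Rightarrow> 'n) \<Rightarrow> nat \<Rightarrow> int \<Rightarrow> int \<Rightarrow> 'n form set set vspace"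
  where "graded_H br k p n =
    vs_quot ((cohomology br n)\<lparr>vs_carrier := filtr_H br k p n\<rparr>) (filtr_H br k (p + 1) n)"

definition graded_class ::
    "('n::real_vector \<Rightarrow> 'n \<Rightarrow> 'n) \<Rightarrow> nat \<Rightarrow> int \<Rightarrow> int \<Rightarrow> 'n form set \<Rightarrow> 'n form set set"
  where "graded_class br k p n h = vs_coset (cohomology br n) (filtr_H br k (p + 1) n) h"

text \<open>
  The natural identification of \<open>E\<^sub>\<infinity>\<^sup>p\<^sup>,\<^sup>q\<close> with \<open>F\<^sup>p H\<^sup>n / F\<^sup>p\<^sup>+\<^sup>1 H\<^sup>n\<close>, \<open>n = p + q\<close>, sends the class of a
  cocycle \<open>x\<close> in \<open>F\<^sup>p C\<^sup>n\<close> to the class of its cohomology class.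
\<close>

definition limit_to_graded ::
    "('n::real_vector \<Rightarrow> 'n \<Rightarrow> 'n) \<Rightarrow> nat \<Rightarrow> int \<Rightarrow> int \<Rightarrow> 'n form set \<Rightarrow> 'n form set set"
  where "limit_to_graded br k p q X =
    (THE Y. \<exists>x \<in> X. x \<in> cocycles br (p + q) \<inter> filtr br k p (p + q) \<and>
       Y = graded_class br k p (p + q) (cohomology_class br (p + q) x))"

text \<open>
  \<open>E\<^sub>\<infinity>\<^sup>p\<^sup>,\<^sup>q = H\<^sup>n\<close>, \<open>n = p + q\<close>, through the graded piece: \<open>F\<^sup>p H\<^sup>n\<close> is all of \<open>H\<^sup>n\<close> and \<open>F\<^sup>p\<^sup>+\<^sup>1 H\<^sup>n\<close> is zero,
  so that the graded piece is \<open>H\<^sup>n\<close> itself (up to \<open>H\<^sup>n / 0 = H\<^sup>n\<close>), and \<open>\<phi>\<close> is the resulting isomorphism.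
\<close>

definition limit_eq_cohomology ::
    "('n::real_vector \<Rightarrow> 'n \<Rightarrow> 'n) \<Rightarrow> nat \<Rightarrow> int \<Rightarrow> int \<Rightarrow> bool"
  where "limit_eq_cohomology br k p q \<longleftrightarrow>
    vs_iso (ss_E_inf br k p q) (graded_H br k p (p + q)) (limit_to_graded br k p q) \<and>
    filtr_H br k p (p + q) = vs_carrier (cohomology br (p + q)) \<and>
    filtr_H br k (p + 1) (p + q) = {vs_zero (cohomology br (p + q))} \<and>
    (\<exists>\<phi>. vs_iso (ss_E_inf br k p q) (cohomology br (p + q)) \<phi> \<and>
      (\<forall>X \<in> vs_carrier (ss_E_inf br k p q).
         graded_class br k p (p + q) (\<phi> X) = limit_to_graded br k p q X))"

end

theory Submission
  imports Defs
begin

text \<open>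
  Write \<open>\<nn>\<^sup>i\<close> for the descending series and \<open>F\<^sup>p\<close> for the filtration.  The elements of \<open>\<Lambda>\<^sup>q V\<^sub>i\<close> are
  exactly the alternating \<open>q\<close>-forms that vanish as soon as one argument lies in \<open>\<nn>\<^sup>i\<close>
  (\<open>ext_power_annihilator\<close>, \<open>V_space_eq_annihilator\<close>).  So \<open>F\<^sup>p C\<^sup>q\<close> consists of the forms killed by
  \<open>\<nn>\<^sup>k\<^sup>-\<^sup>p\<close>, and the whole argument can be made with values of forms on vectors.

  In total degree \<open>n\<close> the limit term is
  \<open>E\<^sub>\<infinity>\<^sup>p\<^sup>,\<^sup>q = (Z\<^sup>n \<inter> F\<^sup>p) / (B\<^sup>n \<inter> F\<^sup>p + Z\<^sup>n \<inter> F\<^sup>p\<^sup>+\<^sup>1)\<close> (\<open>ss_E_inf_eq\<close>), where \<open>Z\<^sup>n\<close> and \<open>B\<^sup>n\<close> are the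
  cocycles and the coboundaries.  It is all of \<open>H\<^sup>n\<close> if
  \<open>Z\<^sup>n \<subseteq> F\<^sup>p\<close>, \<open>Z\<^sup>n \<inter> F\<^sup>p\<^sup>+\<^sup>1 \<subseteq> B\<^sup>n\<close> and \<open>B\<^sup>n \<subseteq> F\<^sup>p\<close> (\<open>limit_term_eq_cohomology\<close>), and it vanishes if
  \<open>Z\<^sup>n \<subseteq> F\<^sup>p\<^sup>+\<^sup>1\<close> or \<open>Z\<^sup>n \<inter> F\<^sup>p \<subseteq> B\<^sup>n\<close>.

  In degrees 0 and 1 there are no nonzero coboundaries, and \<open>Z\<^sup>n\<close> lies in the last nonzero step
  \<open>F\<^sup>k\<^sup>-\<^sup>1\<close>: for \<open>n = 1\<close> because \<open>dx(u, v) = x([u, v])\<close>, so that closed 1-forms vanish on \<open>\<nn>\<^sup>1\<close>.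

  In degrees \<open>m - 1\<close> and \<open>m\<close> the term with \<open>p = 0\<close> carries everything, and the point is that the
  cocycles in \<open>F\<^sup>1\<close> are exact.  In degree \<open>m\<close> even \<open>F\<^sup>1 C\<^sup>m = 0\<close>, because a top form that kills the
  nonzero space \<open>\<nn>\<^sup>k\<^sup>-\<^sup>1\<close> is zero.  In degree \<open>m - 1\<close> let \<open>k \<ge> 2\<close> and choose a bracket
  \<open>w = [u, v] \<noteq> 0\<close> in \<open>\<nn>\<^sup>k\<^sup>-\<^sup>1\<close>.  A form in \<open>F\<^sup>1 C\<^sup>m\<^sup>-\<^sup>1\<close> is killed by \<open>w\<close>, hence a multiple of the contraction
  \<open>\<iota>\<^sub>w vol\<close> of a volume form, and this form is exact:
  \<open>d \<iota>\<^sub>v \<iota>\<^sub>u vol = \<iota>\<^sub>[\<^sub>u\<^sub>,\<^sub>v\<^sub>] vol\<close> (\<open>ce_diff_contract_twice\<close>).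

  The last identity and \<open>B\<^sup>m = 0\<close> express that nilpotent Lie algebras are unimodular.  Two tools
  give them quickly: Cartan's formula \<open>\<iota>\<^sub>u d = L\<^sub>u - d \<iota>\<^sub>u\<close> (\<open>ce_diff_Cons\<close>), which turns statements about
  \<open>d\<close> into inductions on the argument list, and a basis in which every bracket with a basis
  vector is a combination of later basis vectors (\<open>flag_basis_exists\<close>), on which all forms \<open>d f\<close> of top
  degree visibly vanish.
\<close>

section \<open>Alternating forms on lists\<close>

text \<open>
  Multilinearity and alternation are phrased by splitting the argument list around one entry, and only
  equal neighbours are required to give zero.  Both conditions then pass to the contraction
  \<open>f (u # _)\<close> by prefixing \<open>u\<close>, which makes every statement below provable by induction on the
  argument list.  The degree of the form is kept out of the definition for the same reason.
\<close>

definition alternating_form :: "'n::real_vector form \<Rightarrow> bool"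
  where "alternating_form f \<longleftrightarrow>
    (\<forall>as bs. linear (\<lambda>x. f (as @ x # bs))) \<and> (\<forall>as x bs. f (as @ x # x # bs) = 0)"

lemma alternating_formI:
  assumes "\<And>as bs. linear (\<lambda>x. f (as @ x # bs))" and "\<And>as x bs. f (as @ x # x # bs) = 0"
  shows "alternating_form f"
  using assms by (auto simp: alternating_form_def)

lemma alternating_form_linear: "alternating_form f \<Longrightarrow> linear (\<lambda>x. f (as @ x # bs))"
  by (auto simp: alternating_form_def)

lemma alternating_form_adjacent: "alternating_form f \<Longrightarrow> f (as @ x # x # bs) = 0"
  by (auto simp: alternating_form_def)

lemma alternating_bilinear_swap:
  fixes g :: "'a::real_vector \<Rightarrow> 'a \<Rightarrow> real"
  assumes "\<And>y. linear (\<lambda>x. g x y)" and "\<And>x. linear (g x)" and "\<And>x. g x x = 0"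
  shows "g x y = - g y x"
proof -
  have "0 = g (x + y) (x + y)" using assms(3) by simp
  also have "\<dots> = g x x + g x y + g y x + g y y"
    using linear_add[OF assms(1)] linear_add[OF assms(2)] by simp
  finally show ?thesis using assms(3) by simp
qed

lemma alternating_form_swap_adjacent:
  assumes "alternating_form f"
  shows "f (as @ x # y # bs) = - f (as @ y # x # bs)"
proof (rule alternating_bilinear_swap[where g = "\<lambda>x y. f (as @ x # y # bs)"])
  show "linear (\<lambda>x. f (as @ x # y # bs))" for y
    by (rule alternating_form_linear[OF assms])
  show "linear (\<lambda>y. f (as @ x # y # bs))" for x
    using alternating_form_linear[OF assms, of "as @ [x]" bs] by simp
qed (rule alternating_form_adjacent[OF assms])

lemma alternating_form_move_front:
  assumes "alternating_form f"
  shows "f (as @ y # bs) = (- 1) ^ length as * f (y # as @ bs)"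
proof (induction as arbitrary: bs rule: rev_induct)
  case (snoc a as)
  have "f ((as @ [a]) @ y # bs) = - f (as @ y # a # bs)"
    using alternating_form_swap_adjacent[OF assms, of as a y bs] by simp
  also have "f (as @ y # a # bs) = (- 1) ^ length as * f (y # as @ a # bs)"
    by (rule snoc.IH)
  finally show ?case by simp
qed simp

lemma alternating_form_repeated:
  assumes "alternating_form f"
  shows "f (as @ x # bs @ x # cs) = 0"
  using alternating_form_move_front[OF assms, of "as @ x # bs" x cs]
    alternating_form_move_front[OF assms, of "x # as" x "bs @ cs"]
    alternating_form_adjacent[OF assms, of "[]" x "as @ bs @ cs"]
  by simp

lemma alternating_form_not_distinct:
  assumes "alternating_form f" and "\<not> distinct us"
  shows "f us = 0"
proof -
  obtain as x bs cs where "us = as @ [x] @ bs @ [x] @ cs"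
    using not_distinct_decomp[OF assms(2)] by blast
  then show ?thesis using alternating_form_repeated[OF assms(1)] by simp
qed

lemma alternating_form_swap:
  assumes "alternating_form f"
  shows "f (as @ x # bs @ y # cs) = - f (as @ y # bs @ x # cs)"
proof (rule alternating_bilinear_swap[where g = "\<lambda>x y. f (as @ x # bs @ y # cs)"])
  show "linear (\<lambda>x. f (as @ x # bs @ y # cs))" for y
    by (rule alternating_form_linear[OF assms])
  show "linear (\<lambda>y. f (as @ x # bs @ y # cs))" for x
    using alternating_form_linear[OF assms, of "as @ x # bs" cs] by simp
qed (rule alternating_form_repeated[OF assms])

text \<open>
  Translates between positions, in which permutations act, and the splittings of a list in which
  alternation is phrased.
\<close>

lemma permute_list_transpose_decomp:
  assumes "a < b" and "b < length us"
  obtains as x bs y cs where "us = as @ x # bs @ y # cs"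
    and "permute_list (Transposition.transpose a b) us = as @ y # bs @ x # cs"
proof -
  define as bs cs where "as = take a us" and "bs = take (b - a - 1) (drop (Suc a) us)"
    and "cs = drop (Suc b) us"
  have "drop (Suc a) us = bs @ us ! b # cs"
    using id_take_nth_drop[of "b - a - 1" "drop (Suc a) us"] assms
    by (simp add: bs_def cs_def)
  then have us: "us = as @ us ! a # bs @ us ! b # cs"
    using id_take_nth_drop[of a us] assms by (simp add: as_def)
  have len: "length as = a" "length bs = b - a - 1"
    using assms by (auto simp: as_def bs_def)
  have "permute_list (Transposition.transpose a b) us = as @ us ! b # bs @ us ! a # cs"
    (is "?l = ?r")
  proof (rule nth_equalityI)
    show "length ?l = length ?r" using us by (metis length_append length_Cons length_permute_list)
    fix i assume "i < length ?l"
    then have i: "i < length us" by simp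
    have tr: "Transposition.transpose a b permutes {..<length us}"
      using assms by (auto intro: permutes_swap_id)
    have "?l ! i = us ! Transposition.transpose a b i"
      by (rule permute_list_nth[OF tr i])
    also have "\<dots> = ?r ! i"
    proof (cases "i = a \<or> i = b")
      case True
      then show ?thesis using len assms by (auto simp: nth_append)
    next
      case False
      then have "us ! i = ?r ! i"
        using len assms(1) by (subst us) (auto simp: nth_append nth_Cons')
      then show ?thesis using False by (simp add: Transposition.transpose_def)
    qed
    finally show "?l ! i = ?r ! i" .
  qed
  then show ?thesis using us that by blast
qed

text \<open>
  A permutation is a product of transpositions, and exchanging two entries changes the sign.
\<close>

lemma alternating_form_permute_list:
  assumes "alternating_form f" and "\<sigma> permutes {..<length us}"
  shows "f (permute_list \<sigma> us) = of_int (sign \<sigma>) * f us"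
proof -
  have transposed: "f (permute_list (Transposition.transpose a b) vs) = - f vs"
    if ab: "a < length vs" "b < length vs" "a \<noteq> b" for a b and vs :: "'a list"
  proof -
    have *: "f (permute_list (Transposition.transpose a b) vs) = - f vs"
      if "a < b" "b < length vs" for a b
      using permute_list_transpose_decomp[OF that] alternating_form_swap[OF assms(1)] by metis
    show ?thesis
      using *[of a b] *[of b a] ab by (cases "a < b") (auto simp: transpose_commute)
  qed
  define n where "n = length us"
  have "\<forall>us. length us = n \<longrightarrow> f (permute_list \<sigma> us) = of_int (sign \<sigma>) * f us"
    using assms(2) finite_lessThan[of n] unfolding n_def[symmetric]
  proof (induction rule: permutes_induct)
    case id
    then show ?case by (simp add: sign_id)
  next
    case (swap a b p)
    show ?case
    proof (intro allI impI)
      fix us :: "'a list" assume n: "length us = n"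
      have "permute_list (Transposition.transpose a b \<circ> p) us =
          permute_list p (permute_list (Transposition.transpose a b) us)"
        using swap.hyps n by (intro permute_list_compose) auto
      moreover have "permutation p" using swap.hyps(4) permutation_permutes by blast
      ultimately show "f (permute_list (Transposition.transpose a b \<circ> p) us) =
          of_int (sign (Transposition.transpose a b \<circ> p)) * f us"
        using swap.IH swap.hyps transposed[of a us b] n
        by (simp add: sign_compose permutation_swap_id sign_swap_id)
    qed
  qed
  then show ?thesis by (simp add: n_def)
qed

lemma alternating_form_zero: "alternating_form (0 :: 'n::real_vector form)"
  by (rule alternating_formI) (auto intro: linearI)

lemma alternating_form_add:
  assumes "alternating_form f" and "alternating_form g"
  shows "alternating_form (f + g)"
proof (rule alternating_formI)
  show "linear (\<lambda>x. (f + g) (as @ x # bs))" for as bs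
    using linear_compose_add[OF alternating_form_linear[OF assms(1)] alternating_form_linear[OF assms(2)]]
    by simp
qed (simp add: alternating_form_adjacent assms)

lemma scaleR_fun_apply [simp]: "(c *\<^sub>R f) x = c *\<^sub>R f x"
  by (simp add: scaleR_fun_def)

lemma alternating_form_scaleR:
  assumes "alternating_form f"
  shows "alternating_form (c *\<^sub>R f)"
proof (rule alternating_formI)
  show "linear (\<lambda>x. (c *\<^sub>R f) (as @ x # bs))" for as bs
    using linear_compose_scale_right[OF alternating_form_linear[OF assms], of c as bs]
    by (simp add: scaleR_fun_apply)
qed (simp add: alternating_form_adjacent assms scaleR_fun_apply)

text \<open>
  The interior product \<open>\<iota>\<^sub>u f\<close>.
\<close>

definition contraction :: "'n \<Rightarrow> 'n form \<Rightarrow> 'n form"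
  where "contraction u f = (\<lambda>us. f (u # us))"

lemma contraction_apply: "contraction u f us = f (u # us)"
  by (simp add: contraction_def)

lemma contraction_add_scaleR:
  "contraction u (f + g) = contraction u f + contraction u g"
  "contraction u (c *\<^sub>R f) = c *\<^sub>R contraction u f"
  by (simp_all add: fun_eq_iff contraction_apply)

lemma alternating_form_contraction:
  assumes "alternating_form f"
  shows "alternating_form (contraction u f)"
proof (rule alternating_formI)
  show "linear (\<lambda>x. contraction u f (as @ x # bs))" for as bs
    using alternating_form_linear[OF assms, of "u # as" bs] by (simp add: contraction_apply)
  show "contraction u f (as @ x # x # bs) = 0" for as x bs
    using alternating_form_adjacent[OF assms, of "u # as" x bs] by (simp add: contraction_apply)
qed

lemma alternating_form_eq_0_on_span:
  assumes f: "alternating_form f" and S: "x \<in> span S"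
    and zero: "\<And>y. y \<in> S \<Longrightarrow> f (as @ y # bs) = 0"
  shows "f (as @ x # bs) = 0"
  using linear_eq_0_on_span[OF alternating_form_linear[OF f, of as bs] zero S] by simp

text \<open>
  The form descends to the quotient by \<open>W\<close>, where \<open>es\<close> spans.  By multilinearity only lists with
  entries in \<open>es\<close> matter; a list without repetition that is at least as long as \<open>es\<close> is a
  permutation of \<open>es\<close>.  This one statement says that forms above the top degree vanish, that a top
  form is determined by one value, and, with \<open>W\<close> a line, the same for the quotient by that line.
\<close>

lemma alternating_form_top_eq_0:
  fixes f :: "'n::real_vector form"
  assumes f: "alternating_form f" and kills: "\<And>us. set us \<inter> W \<noteq> {} \<Longrightarrow> f us = 0"
    and es: "f es = 0" and span: "span (set es \<union> W) = UNIV" and len: "length es \<le> length us"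
  shows "f us = 0"
proof -
  have basis: "f vs = 0" if vs: "set vs \<subseteq> set es \<union> W" "length es \<le> length vs" for vs
  proof (cases "set vs \<inter> W = {} \<and> distinct vs")
    case True
    then have sub: "set vs \<subseteq> set es" using vs(1) by blast
    have card: "card (set vs) = length vs" using True distinct_card by blast
    have "card (set vs) \<le> card (set es)" by (rule card_mono[OF _ sub]) simp
    then have len': "length vs = length es" "card (set es) = length es" "card (set vs) = card (set es)"
      using card vs(2) card_length[of es] by linarith+
    then have "set vs = set es" using sub card_subset_eq[of "set es" "set vs"] by simp
    moreover have "distinct es" using len'(2) card_distinct by blast
    ultimately have "mset es = mset vs" using True set_eq_iff_mset_eq_distinct by blast
    then obtain p where "p permutes {..<length es}" "permute_list p es = vs"
      using mset_eq_permutation by metis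
    then show ?thesis using alternating_form_permute_list[OF f] es by auto
  next
    case False
    then show ?thesis using kills alternating_form_not_distinct[OF f] by blast
  qed
  \<comment> \<open>The entries of the prefix \<open>as\<close> are arbitrary; they are replaced by spanning vectors from the right.\<close>
  have "f (as @ vs) = 0" if "set vs \<subseteq> set es \<union> W" "length es \<le> length (as @ vs)" for as vs
    using that
  proof (induction as arbitrary: vs rule: rev_induct)
    case Nil
    then show ?case using basis by simp
  next
    case (snoc a as)
    have "f (as @ a # vs) = 0"
    proof (rule alternating_form_eq_0_on_span[OF f])
      show "a \<in> span (set es \<union> W)" using span by simp
      show "f (as @ y # vs) = 0" if "y \<in> set es \<union> W" for y
        using snoc.IH[of "y # vs"] snoc.prems that by simp
    qed
    then show ?case by simp
  qed
  from this[of "[]" us] show ?thesis using len by simp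
qed

section \<open>Exterior powers\<close>

lemma wedge_Nil: "wedge [] us = (if us = [] then 1 else 0)"
  by (simp add: wedge_def)

lemma wedge_singleton: "wedge [x] us = (if length us = 1 then x (us ! 0) else 0)"
  by (simp add: wedge_def lessThan_Suc)

text \<open>
  In each summand of the determinant the variable vector occurs in exactly one factor.  Composing
  with the transposition of the two equal neighbours pairs the summands with opposite signs.
\<close>

lemma alternating_form_wedge:
  assumes lin: "\<And>x. x \<in> set xs \<Longrightarrow> linear x"
  shows "alternating_form (wedge xs)"
proof (rule alternating_formI)
  fix as bs :: "'a list"
  define q where "q = length xs"
  let ?p = "length as"
  let ?u = "\<lambda>x. as @ x # bs"
  show "linear (\<lambda>x. wedge xs (?u x))"
  proof (cases "Suc (length as + length bs) = q")
    case False
    then show ?thesis by (simp add: wedge_def q_def linear_zero)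
  next
    case True
    have term_linear: "linear (\<lambda>x. of_int (sign \<sigma>) * (\<Prod>i<q. (xs ! i) (?u x ! \<sigma> i)))"
      if \<sigma>: "\<sigma> permutes {..<q}" for \<sigma>
    proof -
      define i0 where "i0 = inv \<sigma> ?p"
      have i0: "i0 < q" "\<sigma> i0 = ?p"
        using permutes_in_image[OF permutes_inv[OF \<sigma>], of ?p] permutes_inverses(1)[OF \<sigma>] True
        by (auto simp: i0_def)
      have "(\<Prod>i<q. (xs ! i) (?u x ! \<sigma> i)) =
          (\<Prod>i\<in>{..<q} - {i0}. (xs ! i) (?u 0 ! \<sigma> i)) * (xs ! i0) x" for x
      proof -
        have "(\<Prod>i\<in>{..<q} - {i0}. (xs ! i) (?u x ! \<sigma> i)) =
            (\<Prod>i\<in>{..<q} - {i0}. (xs ! i) (?u 0 ! \<sigma> i))"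
        proof (rule prod.cong)
          fix i assume "i \<in> {..<q} - {i0}"
          then have "\<sigma> i \<noteq> ?p" using i0(2) permutes_inj[OF \<sigma>] by (metis DiffE injD singletonI)
          then show "(xs ! i) (?u x ! \<sigma> i) = (xs ! i) (?u 0 ! \<sigma> i)"
            by (auto simp: nth_append nth_Cons')
        qed simp
        then show ?thesis using prod.remove[of "{..<q}" i0 "\<lambda>i. (xs ! i) (?u x ! \<sigma> i)"] i0
          by simp
      qed
      moreover have "linear (xs ! i0)" using lin i0(1) by (simp add: q_def)
      ultimately show ?thesis
        using linear_compose_scale_right[of "xs ! i0"
            "of_int (sign \<sigma>) * (\<Prod>i\<in>{..<q} - {i0}. (xs ! i) (?u 0 ! \<sigma> i))"]
        by (simp add: mult.assoc)
    qed
    have "linear (\<lambda>x. \<Sum>\<sigma> | \<sigma> permutes {..<q}. of_int (sign \<sigma>) * (\<Prod>i<q. (xs ! i) (?u x ! \<sigma> i)))"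
      by (rule linear_compose_sum) (use term_linear in auto)
    then show ?thesis using True by (simp add: wedge_def q_def)
  qed
  fix x
  let ?v = "as @ x # x # bs" and ?t = "Transposition.transpose ?p (Suc ?p)"
  show "wedge xs ?v = 0"
  proof (cases "length ?v = q")
    case False
    then show ?thesis by (simp add: wedge_def q_def)
  next
    case True
    define T where "T \<sigma> = of_int (sign \<sigma>) * (\<Prod>i<q. (xs ! i) (?v ! \<sigma> i))" for \<sigma>
    have t: "?t permutes {..<q}" using True by (intro permutes_swap_id) auto
    have v: "?v ! ?t j = ?v ! j" for j
      by (auto simp: Transposition.transpose_def nth_append)
    have "T (?t \<circ> \<sigma>) = - T \<sigma>" if "\<sigma> permutes {..<q}" for \<sigma>
    proof -
      have "permutation \<sigma>" using that permutation_permutes by blast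
      then show ?thesis
        by (simp add: T_def v sign_compose permutation_swap_id sign_swap_id)
    qed
    moreover have "sum T {\<sigma>. \<sigma> permutes {..<q}} = (\<Sum>\<sigma> | \<sigma> permutes {..<q}. T (?t \<circ> \<sigma>))"
      using setum_permutations_compose_left[OF t, of T] .
    ultimately have "sum T {\<sigma>. \<sigma> permutes {..<q}} = - sum T {\<sigma>. \<sigma> permutes {..<q}}"
      by (simp add: sum_negf)
    then show ?thesis using True by (simp add: wedge_def q_def T_def)
  qed
qed


text \<open>
  The degree is an integer, so that negative degrees give the zero space, as for \<open>ext_power\<close>.
\<close>

definition forms_killing :: "int \<Rightarrow> 'n::real_vector set \<Rightarrow> 'n form set"
  where "forms_killing q W =
    {f. alternating_form f \<and> (\<forall>us. int (length us) \<noteq> q \<longrightarrow> f us = 0) \<and>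
      (\<forall>us. set us \<inter> W \<noteq> {} \<longrightarrow> f us = 0)}"

lemma subspace_forms_killing: "subspace (forms_killing q W)"
  by (auto simp: subspace_def forms_killing_def alternating_form_zero alternating_form_add
      alternating_form_scaleR scaleR_fun_apply)

lemma alternating_form_expand:
  assumes f: "alternating_form f" and B: "finite B" and c: "\<And>x. (\<Sum>b\<in>B. c b x *\<^sub>R b) = x"
  shows "f (as @ us) =
    (\<Sum>I | set I \<subseteq> B \<and> length I = length us. (\<Prod>i<length us. c (I ! i) (us ! i)) * f (as @ I))"
proof (induction us arbitrary: as)
  case Nil
  have "{I. set I \<subseteq> B \<and> I = []} = {[]}" by auto
  then show ?case by simp
next
  case (Cons u us)
  let ?L = "{I. set I \<subseteq> B \<and> length I = length us}"
  let ?h = "\<lambda>I. (\<Prod>i<length (u # us). c (I ! i) ((u # us) ! i)) * f (as @ I)"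
  have "f (as @ u # us) = f (as @ (\<Sum>b\<in>B. c b u *\<^sub>R b) # us)" by (simp add: c)
  also have "\<dots> = (\<Sum>b\<in>B. c b u * f (as @ b # us))"
    using linear_sum[OF alternating_form_linear[OF f, of as us], of "\<lambda>b. c b u *\<^sub>R b" B]
      linear_scale[OF alternating_form_linear[OF f, of as us]] by simp
  also have "\<dots> = (\<Sum>b\<in>B. c b u * (\<Sum>I\<in>?L. (\<Prod>i<length us. c (I ! i) (us ! i)) * f (as @ b # I)))"
    using Cons.IH[of "as @ [b]" for b] by simp
  also have "\<dots> = (\<Sum>b\<in>B. \<Sum>I\<in>?L. ?h (b # I))"
    by (simp add: sum_distrib_left prod.lessThan_Suc_shift mult.assoc del: prod.lessThan_Suc)
  also have "\<dots> = (\<Sum>I\<in>?L. \<Sum>b\<in>B. ?h (b # I))" by (rule sum.swap)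
  also have "\<dots> = (\<Sum>(I, b)\<in>?L \<times> B. ?h (b # I))" by (rule sum.cartesian_product)
  also have "\<dots> = sum ?h ((\<lambda>(I, b). b # I) ` (?L \<times> B))"
    by (subst sum.reindex) (auto simp: inj_on_def case_prod_unfold)
  also have "(\<lambda>(I, b). b # I) ` (?L \<times> B) = {I. set I \<subseteq> B \<and> length I = length (u # us)}"
    using lists_length_Suc_eq[of B "length us"] by simp
  finally show ?case .
qed

text \<open>
  Expand \<open>f\<close> multilinearly in a basis with coordinate functions \<open>c\<close>, apply this to every permutation of the
  arguments, and average with signs.  Summing over all lists \<open>I\<close> rather than over the increasing ones
  costs the factor \<open>1 / n!\<close> and avoids any ordering of the basis.
\<close>

lemma alternating_form_eq_sum_wedge:
  assumes f: "alternating_form f" and B: "finite B" and c: "\<And>x. (\<Sum>b\<in>B. c b x *\<^sub>R b) = x"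
    and deg: "\<And>us. length us \<noteq> n \<Longrightarrow> f us = 0"
  shows "f = (\<Sum>I | set I \<subseteq> B \<and> length I = n. (f I / fact n) *\<^sub>R wedge (map c I))"
proof
  fix us
  let ?L = "{I. set I \<subseteq> B \<and> length I = n}" and ?P = "{\<sigma>. \<sigma> permutes {..<n}}"
  have sum_apply: "(\<Sum>i\<in>S. g i) x = (\<Sum>i\<in>S. g i x)" for S and g :: "'i \<Rightarrow> 'a form" and x
    by (induction S rule: infinite_finite_induct) auto
  show "f us = (\<Sum>I\<in>?L. (f I / fact n) *\<^sub>R wedge (map c I)) us"
  proof (cases "length us = n")
    case False
    then have "wedge (map c I) us = 0" if "I \<in> ?L" for I using that by (simp add: wedge_def)
    then show ?thesis using deg False by (simp add: sum_apply scaleR_fun_apply)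
  next
    case True
    have finL: "finite ?L" by (rule finite_lists_length_eq[OF B])
    have sgn: "of_int (sign \<sigma>) * (of_int (sign \<sigma>) * x) = (x::real)" for \<sigma> :: "nat \<Rightarrow> nat" and x
      by (simp add: sign_def)
    have "(\<Sum>I\<in>?L. f I * wedge (map c I) us) =
        (\<Sum>I\<in>?L. \<Sum>\<sigma>\<in>?P. of_int (sign \<sigma>) * ((\<Prod>i<n. c (I ! i) (us ! \<sigma> i)) * f I))"
      using True by (intro sum.cong) (auto simp: wedge_def sum_distrib_left mult_ac)
    also have "\<dots> = (\<Sum>\<sigma>\<in>?P. \<Sum>I\<in>?L. of_int (sign \<sigma>) * ((\<Prod>i<n. c (I ! i) (us ! \<sigma> i)) * f I))"
      by (rule sum.swap)
    also have "\<dots> = (\<Sum>\<sigma>\<in>?P. f us)"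
    proof (rule sum.cong)
      fix \<sigma> assume "\<sigma> \<in> ?P"
      then have \<sigma>: "\<sigma> permutes {..<length us}" using True by simp
      have "of_int (sign \<sigma>) * f us = f ([] @ permute_list \<sigma> us)"
        using alternating_form_permute_list[OF f \<sigma>] by simp
      also have "\<dots> = (\<Sum>I\<in>?L. (\<Prod>i<n. c (I ! i) (permute_list \<sigma> us ! i)) * f I)"
        by (subst alternating_form_expand[OF f B c]) (simp add: True)
      also have "\<dots> = (\<Sum>I\<in>?L. (\<Prod>i<n. c (I ! i) (us ! \<sigma> i)) * f I)"
        by (intro sum.cong arg_cong2[where f = "(*)"] prod.cong)
          (auto simp: permute_list_nth[OF \<sigma>] True)
      finally show "(\<Sum>I\<in>?L. of_int (sign \<sigma>) * ((\<Prod>i<n. c (I ! i) (us ! \<sigma> i)) * f I)) = f us"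
        using sgn[of \<sigma> "f us"] by (simp add: sum_distrib_left[symmetric])
    qed simp
    also have "\<dots> = fact n * f us" by (simp add: card_permutations)
    finally have "(\<Sum>I\<in>?L. f I * wedge (map c I) us) / fact n = f us" by simp
    then show ?thesis by (simp add: sum_apply scaleR_fun_apply sum_divide_distrib)
  qed
qed

text \<open>
  This describes \<open>\<Lambda>\<^sup>q\<close> of the annihilator of \<open>W\<close> by values of forms instead of by products.
  For the nontrivial inclusion, extend a basis of \<open>W\<close> to the whole space and expand the
  form: the coefficients of those products that involve a coordinate dual to a vector of \<open>W\<close> are values
  of the form on that vector, hence zero, and the other coordinates annihilate \<open>W\<close>.
\<close>

lemma ext_power_annihilator:
  fixes W :: "'n::real_vector set"
  assumes fin: "\<exists>B::'n set. finite B \<and> span B = UNIV" and W: "subspace W"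
  shows "ext_power q {x. linear x \<and> (\<forall>w\<in>W. x w = 0)} = forms_killing q W"
    (is "ext_power q ?V = _")
proof (cases "q < 0")
  case True
  then have "int n \<noteq> q" for n by simp
  then have "forms_killing q W = {0}"
    by (auto simp: forms_killing_def alternating_form_zero)
  then show ?thesis using True by (simp add: ext_power_def)
next
  case False
  define n where "n = nat q"
  have q: "q = int n" using False by (simp add: n_def)
  let ?S = "{wedge xs |xs. int (length xs) = q \<and> set xs \<subseteq> ?V}"
  have "wedge xs \<in> forms_killing q W" if "int (length xs) = q" "set xs \<subseteq> ?V" for xs
  proof -
    have "wedge xs us = 0" if w: "w \<in> set us" "w \<in> W" for us w
    proof (cases "length us = length xs")
      case True
      obtain j where j: "j < length us" "us ! j = w" using w(1) by (auto simp: in_set_conv_nth)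
      have "(\<Prod>i<length xs. (xs ! i) (us ! \<sigma> i)) = 0" if "\<sigma> permutes {..<length xs}" for \<sigma>
      proof (rule prod_zero)
        have "inv \<sigma> j < length xs" "\<sigma> (inv \<sigma> j) = j"
          using permutes_in_image[OF permutes_inv[OF that], of j] permutes_inverses(1)[OF that]
            True j by auto
        moreover have "(xs ! inv \<sigma> j) w = 0"
          using \<open>set xs \<subseteq> ?V\<close> w(2) calculation(1) nth_mem by blast
        ultimately show "\<exists>i\<in>{..<length xs}. (xs ! i) (us ! \<sigma> i) = 0"
          using j by (intro bexI[of _ "inv \<sigma> j"]) auto
      qed simp
      then show ?thesis by (auto simp: wedge_def intro!: sum.neutral)
    qed (simp add: wedge_def)
    moreover have "alternating_form (wedge xs)"
      using that(2) by (intro alternating_form_wedge) blast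
    moreover have "wedge xs us = 0" if "length us \<noteq> length xs" for us
      using that by (simp add: wedge_def)
    ultimately show ?thesis
      unfolding forms_killing_def using that(1) of_nat_eq_iff by blast
  qed
  then have "?S \<subseteq> forms_killing q W" by blast
  then have "span ?S \<subseteq> forms_killing q W" by (rule span_minimal) (rule subspace_forms_killing)
  moreover have "f \<in> span ?S" if f: "f \<in> forms_killing q W" for f
  proof -
    obtain BW where BW: "BW \<subseteq> W" "independent BW" "W \<subseteq> span BW"
      by (rule maximal_independent_subset[of W])
    obtain B where B: "BW \<subseteq> B" "independent B" "UNIV \<subseteq> span B"
      by (rule maximal_independent_subset_extend[OF subset_UNIV BW(2)])
    have spanB: "span B = UNIV" using B(3) by blast
    obtain T :: "'n set" where T: "finite T" "span T = UNIV" using fin by blast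
    have finB: "finite B" using independent_span_bound[OF T(1) B(2)] T(2) by simp
    define c where "c b x = representation B x b" for b x
    have c: "(\<Sum>b\<in>B. c b x *\<^sub>R b) = x" for x
      unfolding c_def using sum_representation_eq[OF B(2) _ finB subset_refl] spanB by simp
    have lin: "linear (c b)" for b
      using B(2) spanB by (intro linearI) (auto simp: c_def representation_add representation_scale)
    \<comment> \<open>Coordinates of a vector of \<open>W\<close> along basis vectors outside \<open>W\<close> vanish.\<close>
    have killed: "c b \<in> ?V" if "b \<notin> BW" for b
    proof -
      have "c b w = 0" if "w \<in> W" for w
      proof -
        have "w \<in> span BW" using BW(3) that by blast
        then have "c b w = representation BW w b"
          using representation_extend[OF B(2) _ B(1)] by (simp add: c_def)
        then show ?thesis using representation_ne_zero[of BW w b] \<open>b \<notin> BW\<close> by auto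
      qed
      then show ?thesis using lin by simp
    qed
    have "f = (\<Sum>I | set I \<subseteq> B \<and> length I = n. (f I / fact n) *\<^sub>R wedge (map c I))"
      using f by (intro alternating_form_eq_sum_wedge[OF _ finB c]) (auto simp: forms_killing_def q)
    also have "\<dots> \<in> span ?S"
    proof (rule span_sum)
      fix I assume "I \<in> {I. set I \<subseteq> B \<and> length I = n}"
      then have I: "length I = n" by simp
      show "(f I / fact n) *\<^sub>R wedge (map c I) \<in> span ?S"
      proof (cases "set I \<inter> BW = {}")
        case True
        then have "set (map c I) \<subseteq> ?V" using killed by auto
        then have "wedge (map c I) \<in> ?S" using I q by (intro CollectI exI[of _ "map c I"]) simp
        then show ?thesis by (intro span_scale span_base)
      next
        case False
        then have "f I = 0" using f BW(1) by (auto simp: forms_killing_def)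
        then show ?thesis by (simp add: span_zero)
      qed
    qed
    finally show ?thesis .
  qed
  ultimately show ?thesis using False by (auto simp: ext_power_def)
qed

section \<open>Cartan's formula for the Chevalley--Eilenberg differential\<close>

text \<open>
  The sum of the values of \<open>f\<close> on the lists in which one entry \<open>v\<close> is replaced by \<open>[u, v]\<close>.  With
  the sign convention of \<open>ce_diff\<close> this is \<open>\<iota>\<^sub>u d + d \<iota>\<^sub>u\<close>.
\<close>

primrec lie_derivative :: "('n \<Rightarrow> 'n \<Rightarrow> 'n) \<Rightarrow> 'n \<Rightarrow> 'n form \<Rightarrow> 'n list \<Rightarrow> real"
  where
    "lie_derivative br u f [] = 0"
  | "lie_derivative br u f (v # us) = f (br u v # us) + lie_derivative br u (contraction v f) us"

lemma lie_derivative_linear_form: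
  "lie_derivative br u (f + g) us = lie_derivative br u f us + lie_derivative br u g us"
  "lie_derivative br u (c *\<^sub>R f) us = c * lie_derivative br u f us"
  by (induction us arbitrary: f g) (simp_all add: contraction_add_scaleR algebra_simps)

lemma lie_derivative_zero_form: "lie_derivative br u 0 us = 0"
  using lie_derivative_linear_form(2)[of br u 0 0 us] by simp

lemma ce_diff_linear_form:
  "ce_diff br (f + g) = ce_diff br f + ce_diff br g"
  "ce_diff br (c *\<^sub>R f) = c *\<^sub>R ce_diff br f"
  by (simp_all add: fun_eq_iff ce_diff_def case_prod_unfold sum.distrib[symmetric]
      sum_distrib_left algebra_simps)

lemma ce_diff_zero_form: "ce_diff br 0 = 0"
  using ce_diff_linear_form(2)[of br 0 0] by simp

lemma ce_diff_Nil: "ce_diff br f [] = 0"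
  by (simp add: ce_diff_def)

lemma contraction_linear_vector:
  assumes "alternating_form f"
  shows "contraction (x + y) f = contraction x f + contraction y f"
    and "contraction (c *\<^sub>R x) f = c *\<^sub>R contraction x f"
  using linear_add[OF alternating_form_linear[OF assms, of "[]"]]
    linear_scale[OF alternating_form_linear[OF assms, of "[]"]] by (simp_all add: fun_eq_iff contraction_apply)

lemma contraction_contraction_same:
  assumes "alternating_form f"
  shows "contraction x (contraction x f) = 0"
  using alternating_form_adjacent[OF assms, of "[]"] by (simp add: fun_eq_iff contraction_apply)

lemma nths_Compl_Cons:
  "nths (v # us) (- {0}) = us"
  "nths (v # us) (- {Suc j}) = v # nths us (- {j})"
  "nths (v # us) (- {0, Suc j}) = nths us (- {j})"
  "nths (v # us) (- {Suc i, Suc j}) = v # nths us (- {i, j})"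
proof -
  have sets: "{l. Suc l \<in> - {0}} = UNIV" "{l. Suc l \<in> - {Suc j}} = - {j}"
    "{l. Suc l \<in> - {0, Suc j}} = - {j}" "{l. Suc l \<in> - {Suc i, Suc j}} = - {i, j}"
    by auto
  show "nths (v # us) (- {0}) = us" unfolding nths_Cons sets by (simp add: nths_all)
  show "nths (v # us) (- {Suc j}) = v # nths us (- {j})" unfolding nths_Cons sets by simp
  show "nths (v # us) (- {0, Suc j}) = nths us (- {j})" unfolding nths_Cons sets by simp
  show "nths (v # us) (- {Suc i, Suc j}) = v # nths us (- {i, j})" unfolding nths_Cons sets by simp
qed

text \<open>
  The bracket stands in front of the remaining entries, as in \<open>ce_diff\<close>; moving it back to position
  \<open>j\<close> costs the sign \<open>(-1)\<^sup>j\<close>.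
\<close>

lemma lie_derivative_eq_sum:
  assumes "alternating_form f"
  shows "(\<Sum>j<length us. (- 1) ^ j * f (br u (us ! j) # nths us (- {j}))) = lie_derivative br u f us"
  using assms
proof (induction us arbitrary: f)
  case (Cons v us)
  have "f (y # v # ws) = - f (v # y # ws)" for y ws
    using alternating_form_swap_adjacent[OF Cons.prems, of "[]" y v ws] by simp
  then have "(\<Sum>j<length (v # us). (- 1) ^ j * f (br u ((v # us) ! j) # nths (v # us) (- {j}))) =
      f (br u v # us) +
      (\<Sum>j<length us. (- 1) ^ j * contraction v f (br u (us ! j) # nths us (- {j})))"
    by (simp add: sum.lessThan_Suc_shift nths_Compl_Cons contraction_apply del: sum.lessThan_Suc)
  then show ?case
    using Cons.IH[OF alternating_form_contraction[OF Cons.prems]]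
    by (simp del: sum.lessThan_Suc)
qed simp

text \<open>
  Cartan's formula \<open>\<iota>\<^sub>u d = L\<^sub>u - d \<iota>\<^sub>u\<close>, read as a recursion for \<open>d\<close> on the argument list.  The pairs
  \<open>(0, j)\<close> give \<open>L\<^sub>u\<close>; in the other pairs \<open>u\<close> stays among the arguments, and moving it in front
  of the bracket changes the sign.
\<close>

theorem ce_diff_Cons:
  assumes "alternating_form f"
  shows "ce_diff br f (u # us) = lie_derivative br u f us - ce_diff br (contraction u f) us"
proof -
  let ?t = "\<lambda>vs (i, j). (- 1) ^ (i + j + 1) * f (br (vs ! i) (vs ! j) # nths vs (- {i, j}))"
  let ?P = "{(i, j). i < j \<and> j < length us}"
  have fin: "finite ?P"
    by (rule finite_subset[of _ "{..<length us} \<times> {..<length us}"]) auto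
  let ?Q = "{(i, j). i < j \<and> j < length (u # us)}"
  let ?L = "(\<lambda>j. (0::nat, Suc j)) ` {..<length us}"
  let ?R = "(\<lambda>(i, j). (Suc i, Suc j)) ` ?P"
  have split: "?Q = ?L \<union> ?R"
  proof
    show "?L \<union> ?R \<subseteq> ?Q" by auto
    show "?Q \<subseteq> ?L \<union> ?R"
    proof
      fix x assume "x \<in> ?Q"
      then obtain i j where x: "x = (i, j)" "i < j" "j < Suc (length us)" by auto
      then obtain j' where j': "j = Suc j'" by (cases j) auto
      show "x \<in> ?L \<union> ?R"
      proof (cases i)
        case 0
        then show ?thesis using x j' by auto
      next
        case (Suc i')
        then have "(i', j') \<in> ?P" using x j' by auto
        then show ?thesis using x(1) j' Suc by force
      qed
    qed
  qed
  have swap: "f (y # u # ws) = - f (u # y # ws)" for y ws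
    using alternating_form_swap_adjacent[OF assms, of "[]" y u ws] by simp
  have "ce_diff br f (u # us) = sum (?t (u # us)) ?Q"
    by (simp add: ce_diff_def case_prod_unfold)
  also have "\<dots> = sum (?t (u # us)) ?L + sum (?t (u # us)) ?R"
    unfolding split using fin by (intro sum.union_disjoint) auto
  also have "sum (?t (u # us)) ?L =
      (\<Sum>j<length us. (- 1) ^ j * f (br u (us ! j) # nths us (- {j})))"
    by (subst sum.reindex) (auto simp: inj_on_def nths_Compl_Cons)
  also have "\<dots> = lie_derivative br u f us"
    by (rule lie_derivative_eq_sum[OF assms])
  also have "sum (?t (u # us)) ?R = - ce_diff br (contraction u f) us"
    by (subst sum.reindex)
      (auto simp: inj_on_def nths_Compl_Cons swap contraction_apply ce_diff_def case_prod_unfold sum_negf[symmetric]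
        intro!: sum.cong)
  finally show ?thesis by simp
qed

lemma lie_derivative_degree:
  assumes "\<And>us. int (length us) \<noteq> q \<Longrightarrow> f us = 0" and "int (length us) \<noteq> q"
  shows "lie_derivative br u f us = 0"
  using assms
proof (induction us arbitrary: f q)
  case (Cons v us)
  have "f (br u v # us) = 0" using Cons.prems by simp
  moreover have "lie_derivative br u (contraction v f) us = 0"
    by (rule Cons.IH[of "q - 1"]) (use Cons.prems in \<open>auto simp: contraction_apply\<close>)
  ultimately show ?case by simp
qed simp

lemma ce_diff_degree:
  assumes "alternating_form f" and "\<And>us. int (length us) \<noteq> q \<Longrightarrow> f us = 0"
    and "int (length us) \<noteq> q + 1"
  shows "ce_diff br f us = 0"
  using assms
proof (induction us arbitrary: f q)
  case (Cons u us)
  have "ce_diff br (contraction u f) us = 0"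
    by (rule Cons.IH[OF alternating_form_contraction[OF Cons.prems(1)], of "q - 1"])
      (use Cons.prems in \<open>auto simp: contraction_apply\<close>)
  moreover have "lie_derivative br u f us = 0"
    by (rule lie_derivative_degree[of q]) (use Cons.prems in auto)
  ultimately show ?case using ce_diff_Cons[OF Cons.prems(1)] by simp
qed (simp add: ce_diff_Nil)

context real_lie_algebra
begin

lemma br_linear: "linear (br x)" "linear (\<lambda>x. br x y)"
  using bilinear by (auto simp: bilinear_def)

lemma br_antisym: "br x y = - br y x"
proof -
  have "0 = br (x + y) (x + y)" by (simp add: alternating)
  also have "\<dots> = br x x + br x y + br y x + br y y"
    by (simp add: linear_add[OF br_linear(1)] linear_add[OF br_linear(2)])
  finally show ?thesis by (simp add: alternating eq_neg_iff_add_eq_0)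
qed

lemma lie_derivative_linear_vector:
  assumes "alternating_form f"
  shows "linear (\<lambda>x. lie_derivative br x f us)"
  using assms
proof (induction us arbitrary: f)
  case (Cons v us)
  have "linear (\<lambda>x. f ([] @ br x v # us))"
    using linear_compose[OF br_linear(2) alternating_form_linear[OF Cons.prems, of "[]" us]]
    by (simp add: comp_def)
  then show ?case
    using linear_compose_add[OF _ Cons.IH[OF alternating_form_contraction[OF Cons.prems]]] by simp
qed (simp add: linear_zero)

lemma alternating_form_lie_derivative:
  assumes "alternating_form f"
  shows "alternating_form (lie_derivative br u f)"
proof (rule alternating_formI)
  show "linear (\<lambda>x. lie_derivative br u f (as @ x # bs))" for as bs
    using assms
  proof (induction as arbitrary: f)
    case Nil
    have "linear (\<lambda>x. f (br u x # bs))"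
      using linear_compose[OF br_linear(1) alternating_form_linear[OF Nil, of "[]" bs]]
      by (simp add: comp_def)
    moreover have "linear (\<lambda>x. lie_derivative br u (contraction x f) bs)"
      by (rule linearI)
        (simp_all add: contraction_linear_vector[OF Nil] lie_derivative_linear_form)
    ultimately show ?case using linear_compose_add by simp
  next
    case (Cons a as)
    show ?case
      using linear_compose_add[OF alternating_form_linear[OF Cons.prems, of "br u a # as" bs]
          Cons.IH[OF alternating_form_contraction[OF Cons.prems, of a]]] by simp
  qed
  show "lie_derivative br u f (as @ x # x # bs) = 0" for as x bs
    using assms
  proof (induction as arbitrary: f)
    case Nil
    have "f (br u x # x # bs) = - f (x # br u x # bs)"
      using alternating_form_swap_adjacent[OF Nil, of "[]" "br u x" x bs] by simp
    then show ?case
      by (simp add: contraction_contraction_same[OF Nil] lie_derivative_zero_form contraction_apply)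
  next
    case (Cons a as)
    show ?case
      using alternating_form_adjacent[OF Cons.prems, of "br u a # as" x bs]
        Cons.IH[OF alternating_form_contraction[OF Cons.prems, of a]] by simp
  qed
qed

text \<open>
  By Cartan's formula, induction on the entries before the critical position.  For two equal
  leading entries \<open>\<iota>\<^sub>x \<iota>\<^sub>x d f = (\<iota>\<^sub>x L\<^sub>x - L\<^sub>x \<iota>\<^sub>x) f + d \<iota>\<^sub>x \<iota>\<^sub>x f\<close>, and the commutator is the contraction with
  \<open>[x, x] = 0\<close>.
\<close>

lemma alternating_form_ce_diff:
  assumes "alternating_form f"
  shows "alternating_form (ce_diff br f)"
proof (rule alternating_formI)
  show "linear (\<lambda>x. ce_diff br f (as @ x # bs))" for as bs
    using assms
  proof (induction as arbitrary: f)
    case Nil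
    have "linear (\<lambda>x. ce_diff br (contraction x f) bs)"
      by (rule linearI) (simp_all add: contraction_linear_vector[OF Nil] ce_diff_linear_form)
    then show ?case
      using linear_compose_sub[OF lie_derivative_linear_vector[OF Nil]]
      by (simp add: ce_diff_Cons[OF Nil])
  next
    case (Cons a as)
    show ?case
      using linear_compose_sub[OF
          alternating_form_linear[OF alternating_form_lie_derivative[OF Cons.prems]]
          Cons.IH[OF alternating_form_contraction[OF Cons.prems, of a]]]
      by (simp add: ce_diff_Cons[OF Cons.prems])
  qed
  show "ce_diff br f (as @ x # x # bs) = 0" for as x bs
    using assms
  proof (induction as arbitrary: f)
    case Nil
    show ?case
      by (simp add: ce_diff_Cons[OF Nil] ce_diff_Cons[OF alternating_form_contraction[OF Nil]]
          contraction_contraction_same[OF Nil] ce_diff_zero_form alternating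
          linear_0[OF alternating_form_linear[OF Nil, of "[]", simplified]])
  next
    case (Cons a as)
    show ?case
      using alternating_form_adjacent[OF alternating_form_lie_derivative[OF Cons.prems]]
        Cons.IH[OF alternating_form_contraction[OF Cons.prems, of a]]
      by (simp add: ce_diff_Cons[OF Cons.prems])
  qed
qed

lemma cochains_eq_forms_killing: "(cochains q :: 'n form set) = forms_killing q {0}"
proof -
  have "{x :: 'n \<Rightarrow> real. linear x} = {x. linear x \<and> (\<forall>w\<in>{0}. x w = 0)}"
    by (auto simp: linear_0)
  then show ?thesis
    using ext_power_annihilator[OF finite_dimensional subspace_single_0]
    by (simp only: cochains_def)
qed

lemma cochains_iff:
  fixes f :: "'n form"
  shows "f \<in> cochains q \<longleftrightarrow> alternating_form f \<and> (\<forall>us. int (length us) \<noteq> q \<longrightarrow> f us = 0)"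
proof -
  have "f us = 0" if f: "alternating_form f" and "0 \<in> set us" for us
  proof -
    obtain as bs where "us = as @ 0 # bs" using \<open>0 \<in> set us\<close> split_list by metis
    then show ?thesis using linear_0[OF alternating_form_linear[OF f]] by simp
  qed
  then show ?thesis by (auto simp: cochains_eq_forms_killing forms_killing_def)
qed

lemma subspace_cochains: "subspace (cochains q :: 'n form set)"
  by (auto simp: subspace_def cochains_iff alternating_form_zero alternating_form_add
      alternating_form_scaleR)

lemma ce_diff_cochains:
  assumes "f \<in> cochains q"
  shows "ce_diff br f \<in> cochains (q + 1)"
  using assms ce_diff_degree[of f q] by (auto simp: cochains_iff alternating_form_ce_diff)

section \<open>The descending series and its annihilators\<close>

lemma subspace_descending_series: "subspace (descending_series br i)"
  by (cases i) auto

lemma descending_series_br: "y \<in> descending_series br i \<Longrightarrow> br x y \<in> descending_series br (Suc i)"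
  by (auto intro: span_base)

lemma descending_series_antimono:
  assumes "i \<le> j"
  shows "descending_series br j \<subseteq> descending_series br i"
proof -
  have "descending_series br (Suc i) \<subseteq> descending_series br i" for i
  proof (induction i)
    case (Suc i)
    then show ?case by (simp del: descending_series.simps(1)) (rule span_mono, auto)
  qed simp
  then show ?thesis using assms by (rule lift_Suc_antimono_le)
qed

lemma ce_diff_wedge_singleton:
  assumes "linear x"
  shows "ce_diff br (wedge [x]) [u, v] = x (br u v)"
proof -
  have a: "alternating_form (wedge [x])" by (rule alternating_form_wedge) (use assms in auto)
  show ?thesis
    by (simp add: ce_diff_Cons[OF a] ce_diff_Cons[OF alternating_form_contraction[OF a]]
        ce_diff_Nil wedge_singleton contraction_apply)
qed

text \<open>
  \<open>dx(u, v) = x([u, v])\<close>, so \<open>dx\<close> lies in \<open>\<Lambda>\<^sup>2\<close> of the annihilator of \<open>\<nn>\<^sup>i\<close> exactly if \<open>x\<close> vanishes on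
  all brackets with an entry in \<open>\<nn>\<^sup>i\<close>, which span \<open>\<nn>\<^sup>i\<^sup>+\<^sup>1\<close>.
\<close>

theorem V_space_eq_annihilator:
  "V_space br i = {x. linear x \<and> (\<forall>w\<in>descending_series br i. x w = 0)}"
proof (induction i)
  case 0
  show ?case by (auto simp: fun_eq_iff linear_zero)
next
  case (Suc i)
  have "ce_diff br (wedge [x]) \<in> ext_power 2 (V_space br i) \<longleftrightarrow>
      (\<forall>w\<in>descending_series br (Suc i). x w = 0)" if x: "linear x" for x
  proof -
    let ?d = "ce_diff br (wedge [x])" and ?W = "descending_series br i"
    have "wedge [x] \<in> cochains 1"
      using alternating_form_wedge[of "[x]"] x by (simp add: cochains_iff wedge_singleton)
    then have d: "?d \<in> cochains 2" using ce_diff_cochains by fastforce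
    have "(\<forall>us. set us \<inter> ?W \<noteq> {} \<longrightarrow> ?d us = 0) \<longleftrightarrow> (\<forall>u. \<forall>v\<in>?W. x (br u v) = 0)"
    proof (intro iffI allI ballI impI)
      fix u v assume "\<forall>us. set us \<inter> ?W \<noteq> {} \<longrightarrow> ?d us = 0" "v \<in> ?W"
      then have "?d [u, v] = 0" by auto
      then show "x (br u v) = 0" by (simp add: ce_diff_wedge_singleton[OF x])
    next
      fix us assume 0: "\<forall>u. \<forall>v\<in>?W. x (br u v) = 0" and us: "set us \<inter> ?W \<noteq> {}"
      show "?d us = 0"
      proof (cases "length us = 2")
        case True
        then obtain a b where ab: "us = [a, b]"
          by (metis (no_types) length_0_conv length_Suc_conv numeral_2_eq_2)
        have "x (br a b) = - x (br b a)"
          using br_antisym[of a b] linear_neg[OF x] by metis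
        then have "x (br a b) = 0" using us 0 by (auto simp: ab)
        then show ?thesis by (simp add: ab ce_diff_wedge_singleton[OF x])
      next
        case False
        then show ?thesis using d by (simp add: cochains_iff)
      qed
    qed
    also have "\<dots> \<longleftrightarrow> (\<forall>w\<in>descending_series br (Suc i). x w = 0)"
    proof
      assume "\<forall>u. \<forall>v\<in>?W. x (br u v) = 0"
      then show "\<forall>w\<in>descending_series br (Suc i). x w = 0"
        using linear_eq_0_on_span[OF x, of "{br u v |u v. v \<in> ?W}"]
        unfolding descending_series.simps by blast
    qed (use descending_series_br in blast)
    finally show ?thesis
      using d by (simp add: Suc.IH ext_power_annihilator[OF finite_dimensional
            subspace_descending_series] forms_killing_def cochains_iff)
  qed
  then show ?case by auto
qed

end

section \<open>Lists of basis vectors and the volume form\<close>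

lemma basis_list_extending:
  fixes as :: "'n::real_vector list"
  assumes fin: "\<exists>B::'n set. finite B \<and> span B = UNIV"
    and V: "subspace V" and as: "distinct as" "independent (set as)" "set as \<subseteq> V"
  obtains bs where "distinct (bs @ as)" and "independent (set (bs @ as))" and "span (set (bs @ as)) = V"
    and "set bs \<subseteq> V"
proof -
  obtain B where B: "set as \<subseteq> B" "B \<subseteq> V" "independent B" "V \<subseteq> span B"
    by (rule maximal_independent_subset_extend[OF as(3,2)])
  obtain T :: "'n set" where T: "finite T" "span T = UNIV" using fin by blast
  have "finite B" using independent_span_bound[OF T(1) B(3)] T(2) by simp
  then obtain bs where bs: "set bs = B - set as" "distinct bs"
    using finite_distinct_list[of "B - set as"] by auto
  have eq: "set (bs @ as) = B" using bs(1) B(1) by auto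
  show ?thesis
  proof (rule that[of bs])
    show "span (set (bs @ as)) = V"
      unfolding eq using span_minimal[OF B(2) V] B(4) by blast
    show "independent (set (bs @ as))" unfolding eq by (rule B(3))
    show "distinct (bs @ as)" using bs as(1) by auto
    show "set bs \<subseteq> V" using bs(1) B(2) by auto
  qed
qed

text \<open>
  The determinant with respect to the basis \<open>es\<close>: the wedge product of its coordinate functions.
\<close>

lemma top_form_exists:
  fixes es :: "'n::real_vector list"
  assumes "distinct es" and "independent (set es)" and "span (set es) = UNIV"
  obtains vol where "alternating_form vol" and "\<And>us. length us \<noteq> length es \<Longrightarrow> vol us = 0"
    and "vol es = 1"
proof -
  define c where "c b x = representation (set es) x b" for b x
  have "linear (c b)" for b
    using assms(2,3) by (intro linearI) (auto simp: c_def representation_add representation_scale)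
  then have "alternating_form (wedge (map c es))"
    by (intro alternating_form_wedge) auto
  moreover have "wedge (map c es) us = 0" if "length us \<noteq> length es" for us
    using that by (simp add: wedge_def)
  moreover have "wedge (map c es) es = 1"
  proof -
    let ?n = "length es"
    let ?P = "{\<sigma>. \<sigma> permutes {..<?n}}"
    have "(\<Prod>i<?n. c (es ! i) (es ! \<sigma> i)) = (if \<sigma> = id then 1 else 0)" if \<sigma>: "\<sigma> permutes {..<?n}" for \<sigma>
    proof -
      have \<sigma>': "\<sigma> i < ?n" if "i < ?n" for i using permutes_in_image[OF \<sigma>, of i] that by simp
      have c: "c (es ! i) (es ! \<sigma> i) = (if \<sigma> i = i then 1 else 0)" if "i < ?n" for i
        using representation_basis[OF assms(2), of "es ! \<sigma> i"] \<sigma>'[OF that] that assms(1)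
        by (auto simp: c_def nth_eq_iff_index_eq)
      show ?thesis
      proof (cases "\<sigma> = id")
        case False
        then obtain i where i: "\<sigma> i \<noteq> i" by fastforce
        then have "i < ?n" using permutes_not_in[OF \<sigma>, of i] by auto
        then have "\<exists>i\<in>{..<?n}. c (es ! i) (es ! \<sigma> i) = 0" using c i by (intro bexI[of _ i]) auto
        then show ?thesis using False by (simp add: prod_zero)
      qed (use c in simp)
    qed
    then have "wedge (map c es) es = (\<Sum>\<sigma>\<in>?P. if \<sigma> = id then 1 else 0)"
      by (simp add: wedge_def sign_id cong: sum.cong) (intro sum.cong, auto simp: sign_id)
    also have "\<dots> = 1" by (subst sum.delta) (auto simp: finite_permutations permutes_id)
    finally show ?thesis .
  qed
  ultimately show ?thesis using that by blast
qed

section \<open>Bases adapted to the descending series\<close>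

context real_lie_algebra
begin

text \<open>
  Bracketing an entry with anything gives a combination of the later entries.  All operators \<open>br x\<close>
  are then strictly triangular in the list at once, which is the form in which nilpotency is used.
\<close>

primrec flag :: "'n list \<Rightarrow> bool"
  where
    "flag [] \<longleftrightarrow> True"
  | "flag (e # bs) \<longleftrightarrow> (\<forall>x. br x e \<in> span (set bs)) \<and> flag bs"

text \<open>
  Replacing an entry by a combination of later entries gives a combination of lists with a repeated entry.
  In top degree this says that \<open>ad x\<close> has trace zero.
\<close>

lemma lie_derivative_flag:
  assumes "alternating_form f" and "flag bs"
  shows "lie_derivative br x f bs = 0"
  using assms
proof (induction bs arbitrary: f)
  case (Cons b bs)
  have "f ([] @ br x b # bs) = 0"
    by (rule alternating_form_eq_0_on_span[OF Cons.prems(1), of _ "set bs"])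
      (use Cons.prems in \<open>auto intro: alternating_form_not_distinct\<close>)
  then show ?case
    using Cons.IH[OF alternating_form_contraction[OF Cons.prems(1)]] Cons.prems by simp
qed simp

lemma ce_diff_flag:
  assumes "alternating_form f" and "flag bs"
  shows "ce_diff br f bs = 0"
  using assms
proof (induction bs arbitrary: f)
  case (Cons b bs)
  then show ?case
    by (simp add: ce_diff_Cons lie_derivative_flag alternating_form_contraction)
qed (simp add: ce_diff_Nil)

lemma flag_append:
  assumes "\<And>e x. e \<in> set as \<Longrightarrow> br x e \<in> span (set bs)" and "flag bs"
  shows "flag (as @ bs)"
  using assms
proof (induction as)
  case (Cons a as)
  have "span (set bs) \<subseteq> span (set (as @ bs))" by (rule span_mono) simp
  then show ?case using Cons by auto
qed simp

end

locale nilpotent_lie_algebra = real_lie_algebra br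
  for br :: "'n::real_vector \<Rightarrow> 'n \<Rightarrow> 'n" +
  fixes k m :: nat
  assumes step: "step_nilpotent br k" and dim: "dim (UNIV :: 'n set) = m"

context nilpotent_lie_algebra
begin

lemma descending_series_eventually_0: "k \<le> i \<Longrightarrow> descending_series br i = {0}"
  using descending_series_antimono[of k i] step subspace_0[OF subspace_descending_series]
  by (auto simp: step_nilpotent_def)

text \<open>
  A basis of \<open>\<nn>\<^sup>i\<^sup>+\<^sup>1\<close> is extended to one of \<open>\<nn>\<^sup>i\<close> by vectors put in front of it, from the zero
  space \<open>\<nn>\<^sup>k\<close> up to the whole algebra.
\<close>

lemma flag_basis_exists:
  obtains es where "distinct es" and "independent (set es)" and "span (set es) = UNIV" and "flag es"
proof -
  have "\<exists>es. distinct es \<and> independent (set es) \<and> span (set es) = descending_series br (k - j) \<and> flag es"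
    if "j \<le> k" for j
    using that
  proof (induction j)
    case 0
    have "descending_series br k = {0}" by (rule descending_series_eventually_0) simp
    then show ?case by (intro exI[of _ "[]"]) (simp add: independent_empty)
  next
    case (Suc j)
    then obtain es where es: "distinct es" "independent (set es)"
        "span (set es) = descending_series br (k - j)" "flag es" by auto
    have i: "k - j = Suc (k - Suc j)" using Suc.prems by simp
    have sub: "set es \<subseteq> descending_series br (k - Suc j)"
      using span_superset[of "set es"] es(3) descending_series_antimono[of "k - Suc j" "k - j"] by force
    obtain bs where bs: "distinct (bs @ es)" "independent (set (bs @ es))"
        "span (set (bs @ es)) = descending_series br (k - Suc j)" "set bs \<subseteq> descending_series br (k - Suc j)"
      by (rule basis_list_extending[OF finite_dimensional subspace_descending_series es(1,2) sub])
    have "flag (bs @ es)"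
    proof (rule flag_append[OF _ es(4)])
      fix e x assume "e \<in> set bs"
      then have "br x e \<in> descending_series br (k - j)"
        unfolding i using bs(4) by (intro descending_series_br) auto
      then show "br x e \<in> span (set es)" by (simp only: es(3))
    qed
    then show ?case using bs by blast
  qed
  from this[of k] that show ?thesis by auto
qed

lemma basis_length:
  fixes es :: "'n list"
  assumes "distinct es" and "independent (set es)" and "span (set es) = UNIV"
  shows "length es = m"
  using dim_eq_card[of "set es" UNIV] assms dim by (simp add: distinct_card)

section \<open>Forms of degree m and m - 1\<close>

lemma cochains_above_top:
  fixes f :: "'n form"
  assumes f: "f \<in> cochains q" and q: "int m < q"
  shows "f = 0"
proof
  obtain es where es: "distinct es" "independent (set es)" "span (set es) = UNIV" "flag es"
    by (rule flag_basis_exists)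
  have len: "length es = m" by (rule basis_length[OF es(1-3)])
  fix us
  show "f us = 0 us"
  proof (cases "int (length us) = q")
    case True
    have "f us = 0"
      by (rule alternating_form_top_eq_0[of f "{}" es])
        (use f es q len True in \<open>auto simp: cochains_iff\<close>)
    then show ?thesis by simp
  next
    case False
    then show ?thesis using f by (simp add: cochains_iff)
  qed
qed

text \<open>
  \<open>df\<close> is a top form, so it is determined by its value on an adapted basis, where it vanishes.
\<close>

theorem ce_diff_below_top:
  assumes f: "f \<in> cochains (int m - 1)"
  shows "ce_diff br f = 0"
proof
  obtain es where es: "distinct es" "independent (set es)" "span (set es) = UNIV" "flag es"
    by (rule flag_basis_exists)
  have len: "length es = m" by (rule basis_length[OF es(1-3)])
  have d: "ce_diff br f \<in> cochains (int m)" using ce_diff_cochains[OF f] by simp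
  fix us
  show "ce_diff br f us = 0 us"
  proof (cases "length us = m")
    case True
    have "ce_diff br f us = 0"
    proof (rule alternating_form_top_eq_0[of _ "{}" es])
      show "ce_diff br f es = 0" using f es(4) by (auto simp: cochains_iff intro: ce_diff_flag)
    qed (use d es len True in \<open>auto simp: cochains_iff\<close>)
    then show ?thesis by simp
  next
    case False
    then show ?thesis using d by (simp add: cochains_iff)
  qed
qed

text \<open>
  Cartan's formula expresses \<open>L\<^sub>u vol\<close> by \<open>d vol\<close> and \<open>d \<iota>\<^sub>u vol\<close>, and both vanish.
\<close>

lemma lie_derivative_top_form:
  assumes "vol \<in> cochains (int m)"
  shows "lie_derivative br u vol us = 0"
proof -
  have vol: "alternating_form vol" using assms by (simp add: cochains_iff)
  have "contraction u vol \<in> cochains (int m - 1)"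
    using assms by (auto simp: cochains_iff alternating_form_contraction contraction_apply)
  then have "ce_diff br (contraction u vol) = 0" by (rule ce_diff_below_top)
  moreover have "ce_diff br vol = 0"
    by (rule cochains_above_top[OF ce_diff_cochains[OF assms]]) simp
  ultimately show ?thesis using ce_diff_Cons[OF vol, of br u us] by simp
qed

text \<open>
  Since \<open>\<iota>\<^sub>u vol\<close> is closed, Cartan's formula gives \<open>d \<iota>\<^sub>v \<iota>\<^sub>u vol = L\<^sub>v \<iota>\<^sub>u vol\<close>; as \<open>L\<^sub>v vol = 0\<close>, only the term
  in which \<open>[v, u]\<close> replaces \<open>u\<close> survives.  Thus contractions of \<open>vol\<close> with brackets are exact.
\<close>

theorem ce_diff_contract_twice:
  assumes "vol \<in> cochains (int m)"
  shows "ce_diff br (contraction v (contraction u vol)) = contraction (br u v) vol"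
proof
  fix ws
  have vol: "alternating_form vol" using assms by (simp add: cochains_iff)
  have "contraction u vol \<in> cochains (int m - 1)"
    using assms by (auto simp: cochains_iff alternating_form_contraction contraction_apply)
  then have "ce_diff br (contraction u vol) = 0" by (rule ce_diff_below_top)
  then have "ce_diff br (contraction v (contraction u vol)) ws =
      lie_derivative br v (contraction u vol) ws"
    using ce_diff_Cons[OF alternating_form_contraction[OF vol], of br u v ws] by simp
  also have "\<dots> = - vol (br v u # ws)"
    using lie_derivative_top_form[OF assms, of v "u # ws"] by simp
  also have "\<dots> = vol (br u v # ws)"
    using linear_neg[OF alternating_form_linear[OF vol, of "[]" ws], of "br v u"] br_antisym[of u v]
    by simp
  finally show "ce_diff br (contraction v (contraction u vol)) ws = contraction (br u v) vol ws"
    by (simp add: contraction_apply)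
qed

text \<open>
  Modulo \<open>w = [u, v]\<close> the space has dimension \<open>m - 1\<close>, so an \<open>(m - 1)\<close>-form that \<open>w\<close> kills is a multiple
  of \<open>\<iota>\<^sub>w vol = d \<iota>\<^sub>v \<iota>\<^sub>u vol\<close>.
\<close>

theorem form_killing_bracket_exact:
  assumes f: "f \<in> forms_killing (int m - 1) {br u v}" and nz: "br u v \<noteq> 0"
  shows "f \<in> coboundaries br (int m - 1)"
proof -
  let ?w = "br u v"
  have w: "distinct [?w]" "independent (set [?w])" "set [?w] \<subseteq> UNIV"
    using nz by (auto simp: dependent_single)
  obtain bs where bs: "distinct (bs @ [?w])" "independent (set (bs @ [?w]))"
      "span (set (bs @ [?w])) = UNIV"
    by (rule basis_list_extending[OF finite_dimensional subspace_UNIV w])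
  define es where "es = ?w # bs"
  have es: "distinct es" "independent (set es)" "span (set es) = UNIV"
    using bs by (auto simp: es_def)
  have len: "length es = m" by (rule basis_length[OF es])
  obtain vol where vol: "alternating_form vol" "\<And>us. length us \<noteq> m \<Longrightarrow> vol us = 0" "vol es = 1"
    using top_form_exists[OF es] len by metis
  have volC: "vol \<in> cochains (int m)" using vol by (auto simp: cochains_iff)
  define \<eta> where "\<eta> = f bs *\<^sub>R contraction v (contraction u vol)"
  have \<eta>: "\<eta> \<in> cochains (int m - 1 - 1)"
    using vol by (auto simp: \<eta>_def cochains_iff alternating_form_contraction alternating_form_scaleR
        contraction_apply)
  have d\<eta>: "ce_diff br \<eta> = f bs *\<^sub>R contraction ?w vol"
    by (simp add: \<eta>_def ce_diff_linear_form ce_diff_contract_twice[OF volC])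
  define g where "g = f + (- 1) *\<^sub>R ce_diff br \<eta>"
  have fa: "alternating_form f" using f by (simp add: forms_killing_def)
  have g: "alternating_form g"
    unfolding g_def d\<eta>
    by (intro alternating_form_add alternating_form_scaleR alternating_form_contraction fa vol(1))
  have g_apply: "g us = f us - f bs * vol (?w # us)" for us
    by (simp add: g_def d\<eta> contraction_apply)
  have "g us = 0" for us
  proof (cases "int (length us) = int m - 1")
    case True
    show ?thesis
    proof (rule alternating_form_top_eq_0[OF g])
      fix us assume "set us \<inter> {?w} \<noteq> {}"
      moreover from this have "\<not> distinct (?w # us)" by simp
      ultimately show "g us = 0"
        using f alternating_form_not_distinct[OF vol(1)] by (simp add: g_apply forms_killing_def)
    next
      show "g bs = 0" using vol(3) by (simp add: g_apply es_def)
      show "span (set bs \<union> {?w}) = UNIV" using bs(3) by simp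
      show "length bs \<le> length us" using len True by (simp add: es_def)
    qed
  next
    case False
    then show ?thesis using f vol(2)[of "?w # us"] by (auto simp: g_apply forms_killing_def)
  qed
  then have "f = ce_diff br \<eta>" by (auto simp: g_def fun_eq_iff)
  then show ?thesis using \<eta> by (auto simp: coboundaries_def)
qed

end

section \<open>Quotients\<close>

lemma vs_coset_vs_of: "vs_coset (vs_of Z) W x = (+) x ` W"
  by (auto simp: vs_coset_def vs_of_def)

lemma coset_cong:
  assumes "subspace W" and "x - y \<in> W"
  shows "(+) x ` W = (+) y ` W"
proof -
  have "(+) x ` W \<subseteq> (+) y ` W" if "x - y \<in> W" for x y
  proof
    fix z assume "z \<in> (+) x ` W"
    then obtain w where "w \<in> W" "z = x + w" by blast
    then have "z = y + ((x - y) + w)" "(x - y) + w \<in> W"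
      using that assms(1) by (simp_all add: subspace_add)
    then show "z \<in> (+) y ` W" by blast
  qed
  from this[OF assms(2)] this[of y x] show ?thesis
    using subspace_neg[OF assms] by simp
qed

lemma coset_add:
  assumes "subspace W"
  shows "{a + b |a b. a \<in> (+) x ` W \<and> b \<in> (+) y ` W} = (+) (x + y) ` W"
proof (intro equalityI subsetI)
  fix z assume "z \<in> {a + b |a b. a \<in> (+) x ` W \<and> b \<in> (+) y ` W}"
  then obtain v w where "v \<in> W" "w \<in> W" "z = (x + v) + (y + w)" by blast
  then have "z = (x + y) + (v + w)" "v + w \<in> W" using assms by (simp_all add: subspace_add)
  then show "z \<in> (+) (x + y) ` W" by blast
next
  fix z assume "z \<in> (+) (x + y) ` W"
  then obtain w where "w \<in> W" "z = (x + 0) + (y + w)" by (auto simp: add.assoc)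
  then show "z \<in> {a + b |a b. a \<in> (+) x ` W \<and> b \<in> (+) y ` W}"
    using subspace_0[OF assms] by blast
qed

lemma coset_scale:
  assumes "subspace W"
  shows "{c *\<^sub>R a + w |a w. a \<in> (+) x ` W \<and> w \<in> W} = (+) (c *\<^sub>R x) ` W"
proof (intro equalityI subsetI)
  fix z assume "z \<in> {c *\<^sub>R a + w |a w. a \<in> (+) x ` W \<and> w \<in> W}"
  then obtain v w where "v \<in> W" "w \<in> W" "z = c *\<^sub>R (x + v) + w" by blast
  then have "z = c *\<^sub>R x + (c *\<^sub>R v + w)" "c *\<^sub>R v + w \<in> W"
    using assms by (simp_all add: subspace_add subspace_scale scaleR_add_right add.assoc)
  then show "z \<in> (+) (c *\<^sub>R x) ` W" by blast
next
  fix z assume "z \<in> (+) (c *\<^sub>R x) ` W"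
  then obtain w where "w \<in> W" "z = c *\<^sub>R (x + 0) + w" by auto
  then show "z \<in> {c *\<^sub>R a + w |a w. a \<in> (+) x ` W \<and> w \<in> W}"
    using subspace_0[OF assms] by blast
qed

lemma vs_iso_refl: "vs_iso V V (\<lambda>x. x)"
  by (simp add: vs_iso_def bij_betw_def)

lemma vs_quot_zero_iso:
  assumes "bij_betw g S Z" and "\<And>x y. g (x + y) = g x + g y" and "\<And>c x. g (c *\<^sub>R x) = c *\<^sub>R g x"
  shows "vs_iso (vs_of S) (vs_quot (vs_of Z) {0}) (\<lambda>x. vs_coset (vs_of Z) {0} (g x))"
proof -
  have "bij_betw (\<lambda>z. {z}) Z ((\<lambda>z. {z}) ` Z)" by (simp add: bij_betw_def)
  from bij_betw_trans[OF assms(1) this] show ?thesis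
    by (simp add: vs_iso_def vs_coset_vs_of vs_quot_def comp_def assms(2,3) vs_of_def vs_coset_def)
qed

lemma vs_quot_zero_isomorphic:
  assumes "bij_betw g Z S" and "\<And>x y. g (x + y) = g x + g y" and "\<And>c x. g (c *\<^sub>R x) = c *\<^sub>R g x"
  shows "vs_isomorphic (vs_quot (vs_of Z) {0}) (vs_of S)"
proof -
  have "bij_betw the_elem ((\<lambda>z. {z}) ` Z) Z" by (auto simp: bij_betw_def inj_on_def image_image)
  from bij_betw_trans[OF this assms(1)]
  have "vs_iso (vs_quot (vs_of Z) {0}) (vs_of S) (\<lambda>X. g (the_elem X))"
    by (auto simp: vs_iso_def vs_quot_def comp_def assms(2,3) vs_of_def vs_coset_def)
  then show ?thesis by (auto simp: vs_isomorphic_def)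
qed

section \<open>Limit terms of the spectral sequence\<close>

lemma forms_killing_antimono: "W \<subseteq> W' \<Longrightarrow> forms_killing q W' \<subseteq> forms_killing q W"
  by (auto simp: forms_killing_def)

context nilpotent_lie_algebra
begin

lemma k_pos: "1 \<le> k"
  using step by (simp add: step_nilpotent_def)

lemma filtr_eq:
  "filtr br k p q =
    (if p \<le> int k - 1 then forms_killing q (descending_series br (nat (int k - p))) else {0})"
  using ext_power_annihilator[OF finite_dimensional subspace_descending_series]
  by (simp add: filtr_def V_space_eq_annihilator)

lemma subspace_filtr: "subspace (filtr br k p q)"
  by (simp add: filtr_eq subspace_forms_killing subspace_single_0)

text \<open>
  Here \<open>k - p \<ge> k\<close>, so the forms in \<open>F\<^sup>p\<close> only have to vanish on \<open>\<nn>\<^sup>k = 0\<close>.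
\<close>

lemma filtr_nonpos: "p \<le> 0 \<Longrightarrow> filtr br k p q = cochains q"
  using k_pos descending_series_eventually_0[of "nat (int k - p)"]
  by (simp add: filtr_eq cochains_eq_forms_killing)

lemma filtr_antimono:
  assumes "p \<le> p'"
  shows "filtr br k p' q \<subseteq> filtr br k p q"
proof (cases "p' \<le> int k - 1")
  case True
  have "descending_series br (nat (int k - p)) \<subseteq> descending_series br (nat (int k - p'))"
    using assms by (intro descending_series_antimono) simp
  then show ?thesis using True assms forms_killing_antimono by (simp add: filtr_eq)
next
  case False
  then have "filtr br k p' q = {0}" by (simp add: filtr_eq)
  then show ?thesis using subspace_0[OF subspace_filtr] by simp
qed

lemma filtr_cochains: "filtr br k p q \<subseteq> cochains q"
  using filtr_antimono[of "min p 0" p q] filtr_nonpos[of "min p 0" q] by simp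

lemma subspace_cocycles: "subspace (cocycles br n)"
  using subspace_cochains[of n]
  by (auto simp: subspace_def cocycles_def ce_diff_linear_form ce_diff_zero_form)

lemma subspace_coboundaries: "subspace (coboundaries br n)"
proof -
  have "linear (ce_diff br)" by (rule linearI) (simp_all add: ce_diff_linear_form)
  then show ?thesis unfolding coboundaries_def by (rule linear_subspace_image) (rule subspace_cochains)
qed

text \<open>
  What the denominator of \<open>E\<^sub>r\<^sup>p\<^sup>,\<^sup>q\<close> becomes for large \<open>r\<close>, with \<open>n = p + q\<close>.
\<close>

definition limit_denominator :: "int \<Rightarrow> int \<Rightarrow> 'n form set"
  where "limit_denominator p n =
    {b + z | b z. b \<in> coboundaries br n \<inter> filtr br k p n \<and> z \<in> cocycles br n \<inter> filtr br k (p + 1) n}"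

lemma subspace_limit_denominator: "subspace (limit_denominator p n)"
  unfolding limit_denominator_def
  by (intro subspace_sums subspace_inter subspace_coboundaries subspace_cocycles subspace_filtr)

text \<open>
  Once \<open>p + r \<ge> k\<close> the condition \<open>dx \<in> F\<^sup>p\<^sup>+\<^sup>r = 0\<close> says that \<open>x\<close> is closed, and once \<open>p - r + 1 \<le> 0\<close>
  the potentials \<open>y\<close> in the denominator range over all cochains.
\<close>

theorem ss_E_inf_eq:
  assumes n: "p + q = n"
  shows "ss_E_inf br k p q =
    vs_quot (vs_of (cocycles br n \<inter> filtr br k p n)) (limit_denominator p n)"
    (is "_ = ?E")
proof -
  have E: "ss_E br k r p q = ?E" if r: "nat (int k + \<bar>p\<bar> + 1) \<le> r" for r
  proof -
    have r': "int k \<le> p + int r" "p - int r + 1 \<le> 0" using r by linarith+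
    have zero: "filtr br k (p + int r) (n + 1) = {0}" using r' by (simp add: filtr_eq)
    have A: "ss_A br k (int r) p q = cocycles br n \<inter> filtr br k p n"
      using zero filtr_cochains n by (auto simp: ss_A_def cocycles_def)
    have idx: "p - int r + 1 + (q + int r - 2) = n - 1" "p - int r + 1 + (int r - 1) = p"
      "p + 1 + (q - 1) = n" "p + 1 + (int r - 1) = p + int r"
      using n by simp_all
    have B: "ss_A br k (int r - 1) (p - int r + 1) (q + int r - 2) =
        {y \<in> cochains (n - 1). ce_diff br y \<in> filtr br k p n}"
      using filtr_nonpos[OF r'(2)] unfolding ss_A_def idx by simp
    have C: "ss_A br k (int r - 1) (p + 1) (q - 1) = cocycles br n \<inter> filtr br k (p + 1) n"
      using zero filtr_cochains unfolding ss_A_def idx by (auto simp: cocycles_def)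
    have D: "{ce_diff br y + z |y z. y \<in> {y \<in> cochains (n - 1). ce_diff br y \<in> filtr br k p n} \<and>
        z \<in> cocycles br n \<inter> filtr br k (p + 1) n} = limit_denominator p n"
      unfolding limit_denominator_def coboundaries_def by blast
    show ?thesis unfolding ss_E_def A B C D ..
  qed
  show ?thesis
    unfolding ss_E_inf_def
  proof (rule the_equality)
    show "\<exists>r0. \<forall>r\<ge>r0. ss_E br k r p q = ?E" using E by blast
    fix E' assume "\<exists>r0. \<forall>r\<ge>r0. ss_E br k r p q = E'"
    then obtain r0 where "\<forall>r\<ge>r0. ss_E br k r p q = E'" by blast
    then show "E' = ?E" using E[of "max r0 (nat (int k + \<bar>p\<bar> + 1))"] by simp
  qed
qed

lemma ss_E_inf_is_zero:
  assumes "p + q = n" and sub: "cocycles br n \<inter> filtr br k p n \<subseteq> limit_denominator p n"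
  shows "vs_is_zero (ss_E_inf br k p q)"
proof -
  have "(+) x ` limit_denominator p n = limit_denominator p n"
    if "x \<in> cocycles br n \<inter> filtr br k p n" for x
    using coset_cong[OF subspace_limit_denominator, of x 0] sub that by auto
  moreover have "0 \<in> cocycles br n \<inter> filtr br k p n"
    using subspace_0[OF subspace_cocycles] subspace_0[OF subspace_filtr] by simp
  ultimately have "(\<lambda>x. (+) x ` limit_denominator p n) ` (cocycles br n \<inter> filtr br k p n) =
      {limit_denominator p n}"
    by blast
  then show ?thesis
    by (simp add: ss_E_inf_eq[OF assms(1)] vs_is_zero_def vs_quot_def vs_coset_vs_of)
      (simp add: vs_of_def)
qed

lemma ss_E_inf_is_zero_if_cocycles_deeper:
  assumes "p + q = n" and "cocycles br n \<subseteq> filtr br k (p + 1) n"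
  shows "vs_is_zero (ss_E_inf br k p q)"
proof (rule ss_E_inf_is_zero[OF assms(1)])
  have "0 \<in> coboundaries br n \<inter> filtr br k p n"
    using subspace_0[OF subspace_coboundaries] subspace_0[OF subspace_filtr] by simp
  moreover have "x = 0 + x" for x :: "'n form" by simp
  ultimately show "cocycles br n \<inter> filtr br k p n \<subseteq> limit_denominator p n"
    unfolding limit_denominator_def using assms(2) by blast
qed

lemma ss_E_inf_is_zero_if_exact:
  assumes "p + q = n" and "cocycles br n \<inter> filtr br k p n \<subseteq> coboundaries br n"
  shows "vs_is_zero (ss_E_inf br k p q)"
proof (rule ss_E_inf_is_zero[OF assms(1)])
  have "0 \<in> cocycles br n \<inter> filtr br k (p + 1) n"
    using subspace_0[OF subspace_cocycles] subspace_0[OF subspace_filtr] by simp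
  moreover have "x = x + 0" for x :: "'n form" by simp
  ultimately show "cocycles br n \<inter> filtr br k p n \<subseteq> limit_denominator p n"
    unfolding limit_denominator_def using assms(2) by blast
qed

text \<open>
  Under these hypotheses the numerator of the limit term is the space of all cocycles and its
  denominator the space of all coboundaries, so it is the cohomology group itself.  The identification
  with the graded piece is \<open>X \<mapsto> {X}\<close>, because that piece is the quotient by the zero subspace.
\<close>

theorem limit_term_eq_cohomology:
  assumes n: "p + q = n" and Z: "cocycles br n \<subseteq> filtr br k p n"
    and exact: "cocycles br n \<inter> filtr br k (p + 1) n \<subseteq> coboundaries br n"
    and B: "coboundaries br n \<subseteq> filtr br k p n"
  shows "ss_E_inf br k p q = cohomology br n" and "limit_eq_cohomology br k p q"
proof -
  let ?B = "coboundaries br n" and ?H = "cohomology br n"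
  let ?co = "\<lambda>x. (+) x ` ?B"
  note sB = subspace_coboundaries[of n]
  have "limit_denominator p n = ?B"
  proof
    show "limit_denominator p n \<subseteq> ?B"
      unfolding limit_denominator_def using exact subspace_add[OF sB] by blast
    have "0 \<in> cocycles br n \<inter> filtr br k (p + 1) n"
      using subspace_0[OF subspace_cocycles] subspace_0[OF subspace_filtr] by simp
    moreover have "x = x + 0" for x :: "'n form" by simp
    ultimately show "?B \<subseteq> limit_denominator p n"
      unfolding limit_denominator_def using B by blast
  qed
  moreover have "cocycles br n \<inter> filtr br k p n = cocycles br n" using Z by blast
  ultimately show E: "ss_E_inf br k p q = ?H"
    using ss_E_inf_eq[OF n] by (simp add: cohomology_def)
  have H_carrier: "vs_carrier ?H = ?co ` cocycles br n"
    by (simp add: cohomology_def vs_quot_def vs_coset_vs_of vs_of_def[of "cocycles br n"] vs_coset_def)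
      (auto simp: vs_coset_def image_def)
  have H_add: "vs_add ?H (?co x) (?co y) = ?co (x + y)" for x y
    using coset_add[OF sB, of x y] by (simp add: cohomology_def vs_quot_def vs_of_def)
  have H_scale: "vs_scale ?H c (?co x) = ?co (c *\<^sub>R x)" for c x
    using coset_scale[OF sB, of c x] by (simp add: cohomology_def vs_quot_def vs_of_def)
  have H_zero: "vs_zero ?H = ?B" by (simp add: cohomology_def vs_quot_def)
  have cls: "cohomology_class br n x = ?co x" for x
    by (simp add: cohomology_class_def vs_coset_vs_of)
  have co_0: "?co 0 = ?B" by simp
  have F: "filtr_H br k p n = vs_carrier ?H"
    unfolding filtr_H_def H_carrier cls using Z by (simp add: Int_absorb2)
  have "?co x = ?B" if "x \<in> cocycles br n \<inter> filtr br k (p + 1) n" for x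
    using coset_cong[OF sB, of x 0] exact that by auto
  moreover have "0 \<in> cocycles br n \<inter> filtr br k (p + 1) n"
    using subspace_0[OF subspace_cocycles] subspace_0[OF subspace_filtr] by simp
  ultimately have F1: "filtr_H br k (p + 1) n = {?B}"
    unfolding filtr_H_def cls by blast
  have add_B: "vs_add ?H (?co x) ?B = ?co x" for x
    using H_add[of x 0] by simp
  have graded: "graded_class br k p n (?co x) = {?co x}" for x
    by (simp add: graded_class_def vs_coset_def F1 add_B)
  have limit: "limit_to_graded br k p q X = {X}" if X: "X \<in> vs_carrier ?H" for X
  proof -
    obtain x where x: "x \<in> cocycles br n" "X = ?co x" using X by (auto simp: H_carrier)
    have same: "?co y = X" if "y \<in> X" for y
    proof -
      obtain b where "b \<in> ?B" "y = x + b" using \<open>y \<in> X\<close> x(2) by blast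
      then show ?thesis using coset_cong[OF sB, of y x] x(2) by simp
    qed
    have "x \<in> X" using x(2) subspace_0[OF sB] by force
    show ?thesis
      unfolding limit_to_graded_def n cls graded
    proof (rule the_equality)
      show "\<exists>y\<in>X. y \<in> cocycles br n \<inter> filtr br k p n \<and> {X} = {?co y}"
        using \<open>x \<in> X\<close> x(1) Z same by blast
      fix Y assume "\<exists>y\<in>X. y \<in> cocycles br n \<inter> filtr br k p n \<and> Y = {?co y}"
      then show "Y = {X}" using same by blast
    qed
  qed
  have G: "vs_carrier (graded_H br k p n) = (\<lambda>X. {X}) ` vs_carrier ?H"
    by (simp add: graded_H_def vs_quot_def vs_coset_def F F1 H_carrier add_B image_image)
  have "vs_iso ?H (graded_H br k p n) (limit_to_graded br k p q)"
    unfolding vs_iso_def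
  proof (intro conjI ballI allI)
    have "bij_betw (\<lambda>X. {X}) (vs_carrier ?H) (vs_carrier (graded_H br k p n))"
      by (simp add: G bij_betw_def)
    then show "bij_betw (limit_to_graded br k p q) (vs_carrier ?H) (vs_carrier (graded_H br k p n))"
      using limit by (simp cong: bij_betw_cong)
    fix X Y assume X: "X \<in> vs_carrier ?H" and Y: "Y \<in> vs_carrier ?H"
    obtain x y where x: "x \<in> cocycles br n" "X = ?co x" and y: "y \<in> cocycles br n" "Y = ?co y"
      using X Y by (auto simp: H_carrier)
    have "vs_add ?H X Y \<in> vs_carrier ?H"
      using x y subspace_add[OF subspace_cocycles] by (simp add: H_add H_carrier)
    then show "limit_to_graded br k p q (vs_add ?H X Y) =
        vs_add (graded_H br k p n) (limit_to_graded br k p q X) (limit_to_graded br k p q Y)"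
      using X Y by (simp add: limit graded_H_def vs_quot_def)
  next
    fix c X assume X: "X \<in> vs_carrier ?H"
    obtain x where x: "x \<in> cocycles br n" "X = ?co x" using X by (auto simp: H_carrier)
    have "vs_scale ?H c X \<in> vs_carrier ?H"
      using x subspace_scale[OF subspace_cocycles] by (simp add: H_scale H_carrier)
    then show "limit_to_graded br k p q (vs_scale ?H c X) =
        vs_scale (graded_H br k p n) c (limit_to_graded br k p q X)"
      using X x(2) by (simp add: limit graded_H_def vs_quot_def F1 H_scale add_B)
  qed
  moreover have "graded_class br k p n X = limit_to_graded br k p q X" if "X \<in> vs_carrier ?H" for X
    using that limit[OF that] by (auto simp: H_carrier graded)
  ultimately show "limit_eq_cohomology br k p q"
    unfolding limit_eq_cohomology_def n E using F F1 H_zero vs_iso_refl[of ?H]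
    by (intro conjI exI[of _ "\<lambda>X. X"]) auto
qed

section \<open>Cohomology and filtration in degrees 0, 1, m - 1 and m\<close>

lemma coboundaries_0: "coboundaries br 0 = {0}"
proof -
  have "cochains (- 1) = ({0} :: 'n form set)"
    by (simp add: cochains_def ext_power_def)
  then show ?thesis by (simp add: coboundaries_def ce_diff_zero_form)
qed

lemma ce_diff_degree_0:
  assumes "f \<in> cochains 0"
  shows "ce_diff br f = 0"
proof
  fix us
  show "ce_diff br f us = 0 us"
  proof (cases "length us = 1")
    case True
    then obtain u where "us = [u]" by (auto simp: length_Suc_conv)
    then show ?thesis using assms by (simp add: cochains_iff ce_diff_Cons ce_diff_Nil)
  next
    case False
    then show ?thesis using ce_diff_cochains[OF assms] by (simp add: cochains_iff)
  qed
qed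

lemma coboundaries_1: "coboundaries br 1 = {0}"
proof -
  have "coboundaries br 1 \<subseteq> {0}" using ce_diff_degree_0 by (auto simp: coboundaries_def)
  then show ?thesis using subspace_0[OF subspace_coboundaries] by blast
qed

lemma coboundaries_top: "coboundaries br (int m) = {0}"
proof -
  have "coboundaries br (int m) \<subseteq> {0}" using ce_diff_below_top by (auto simp: coboundaries_def)
  then show ?thesis using subspace_0[OF subspace_coboundaries] by blast
qed

lemma coboundaries_cochains: "coboundaries br n \<subseteq> cochains n"
  using ce_diff_cochains[of _ "n - 1"] by (auto simp: coboundaries_def)

lemma cocycles_0_filtr: "cocycles br 0 \<subseteq> filtr br k (int k - 1) 0"
proof
  fix f assume "f \<in> cocycles br 0"
  then have f: "alternating_form f" "\<And>us. us \<noteq> [] \<Longrightarrow> f us = 0"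
    by (auto simp: cocycles_def cochains_iff)
  have "f us = 0" if "set us \<inter> W \<noteq> {}" for us W
    using that by (intro f(2)) auto
  then show "f \<in> filtr br k (int k - 1) 0"
    unfolding filtr_eq forms_killing_def using f by simp
qed

lemma cohomology_0_iso:
  "vs_iso (vs_of (UNIV :: real set)) (cohomology br 0) (\<lambda>c. cohomology_class br 0 (c *\<^sub>R wedge []))"
  unfolding cohomology_def cohomology_class_def coboundaries_0
proof (rule vs_quot_zero_iso)
  have Z: "c *\<^sub>R wedge [] \<in> cocycles br 0" for c
  proof -
    have "c *\<^sub>R wedge [] \<in> (cochains 0 :: 'n form set)"
      using alternating_form_wedge[of "[] :: ('n \<Rightarrow> real) list"]
      by (simp add: cochains_iff alternating_form_scaleR wedge_Nil)
    then show ?thesis by (simp add: cocycles_def ce_diff_degree_0)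
  qed
  have "f = f [] *\<^sub>R wedge []" if "f \<in> cocycles br 0" for f
    using that by (auto simp: cocycles_def cochains_iff wedge_Nil fun_eq_iff)
  then show "bij_betw (\<lambda>c. c *\<^sub>R wedge []) (UNIV :: real set) (cocycles br 0)"
    using Z by (intro bij_betwI[where g = "\<lambda>f. f []"]) (auto simp: wedge_Nil)
qed (simp_all add: scaleR_add_left)

text \<open>
  A closed 1-form vanishes on all brackets, that is on \<open>\<nn>\<^sup>1\<close>, so it lies in \<open>V\<^sub>1\<close>, the deepest nonzero
  step of the filtration.
\<close>

lemma closed_1_form:
  assumes f: "f \<in> cocycles br 1"
  shows "f \<in> filtr br k (int k - 1) 1" and "linear (\<lambda>u. f [u])" and "f = wedge [\<lambda>u. f [u]]"
proof -
  have fa: "alternating_form f" and deg: "\<And>us. length us \<noteq> 1 \<Longrightarrow> f us = 0" and d: "ce_diff br f = 0"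
    using f by (auto simp: cocycles_def cochains_iff)
  show lin: "linear (\<lambda>u. f [u])" using alternating_form_linear[OF fa, of "[]" "[]"] by simp
  show w: "f = wedge [\<lambda>u. f [u]]"
  proof
    fix us show "f us = wedge [\<lambda>u. f [u]] us"
      using deg[of us] by (cases us) (auto simp: wedge_singleton)
  qed
  have "f [br u v] = 0" for u v
    using ce_diff_wedge_singleton[OF lin, of u v] d by (simp flip: w)
  then have "f [a] = 0" if "a \<in> descending_series br 1" for a
    using linear_eq_0_on_span[OF lin, of "{br x y |x y. y \<in> UNIV}" a] that by auto
  then have "f us = 0" if "set us \<inter> descending_series br 1 \<noteq> {}" for us
  proof (cases "length us = 1")
    case True
    then obtain a where "us = [a]" by (auto simp: length_Suc_conv)
    then show ?thesis using that \<open>\<And>a. a \<in> descending_series br 1 \<Longrightarrow> f [a] = 0\<close> by auto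
  qed (rule deg)
  then have "f \<in> forms_killing 1 (descending_series br 1)"
    using fa deg by (auto simp: forms_killing_def)
  then show "f \<in> filtr br k (int k - 1) 1" by (simp add: filtr_eq)
qed

lemma cohomology_1_iso:
  "vs_iso (vs_of (ker_d br)) (cohomology br 1) (\<lambda>x. cohomology_class br 1 (wedge [x]))"
  unfolding cohomology_def cohomology_class_def coboundaries_1
proof (rule vs_quot_zero_iso)
  have "wedge [x] \<in> cocycles br 1" if "x \<in> ker_d br" for x
    using that alternating_form_wedge[of "[x]"]
    by (auto simp: ker_d_def cocycles_def cochains_iff wedge_singleton)
  moreover have "(\<lambda>u. f [u]) \<in> ker_d br" if "f \<in> cocycles br 1" for f
    using closed_1_form[OF that] that by (simp add: ker_d_def cocycles_def)
  ultimately show "bij_betw (\<lambda>x. wedge [x]) (ker_d br) (cocycles br 1)"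
    using closed_1_form(3)
    by (intro bij_betwI[where g = "\<lambda>f u. f [u]"]) (auto simp: wedge_singleton)
qed (simp_all add: fun_eq_iff wedge_singleton)

text \<open>
  It suffices to treat \<open>p = 1\<close>.  If \<open>k \<ge> 2\<close>, forms in \<open>F\<^sup>1\<close> vanish on \<open>\<nn>\<^sup>k\<^sup>-\<^sup>1\<close>, which is nonzero and spanned by
  brackets, so they are killed by some bracket \<open>[u, v] \<noteq> 0\<close>.  If \<open>k = 1\<close>, then \<open>F\<^sup>1 = 0\<close> by definition.
\<close>

lemma filtr_below_top_exact:
  assumes p: "1 \<le> p"
  shows "filtr br k p (int m - 1) \<subseteq> coboundaries br (int m - 1)"
proof -
  have "filtr br k 1 (int m - 1) \<subseteq> coboundaries br (int m - 1)"
  proof (cases "2 \<le> k")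
    case True
    then have i: "k - 1 = Suc (k - 2)" by simp
    have "\<not> descending_series br (k - 1) \<subseteq> {0}"
      using step subspace_0[OF subspace_descending_series] by (auto simp: step_nilpotent_def)
    then obtain u v where uv: "v \<in> descending_series br (k - 2)" "br u v \<noteq> 0"
      unfolding i descending_series.simps
      using span_minimal[OF _ subspace_single_0, of "{br x y |x y. y \<in> descending_series br (k - 2)}"]
      by auto
    have "br u v \<in> descending_series br (k - 1)"
      unfolding i by (rule descending_series_br[OF uv(1)])
    then have "forms_killing (int m - 1) (descending_series br (k - 1)) \<subseteq>
        forms_killing (int m - 1) {br u v}"
      by (intro forms_killing_antimono) simp
    moreover have "filtr br k 1 (int m - 1) = forms_killing (int m - 1) (descending_series br (k - 1))"
      using True by (simp add: filtr_eq nat_diff_distrib)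
    ultimately show ?thesis using form_killing_bracket_exact[OF _ uv(2)] by auto
  next
    case False
    then have "filtr br k 1 (int m - 1) = {0}" by (simp add: filtr_eq)
    then show ?thesis using subspace_0[OF subspace_coboundaries] by simp
  qed
  then show ?thesis using filtr_antimono[OF p] by blast
qed

text \<open>
  A top form that vanishes whenever a fixed nonzero vector is among the arguments is zero, because that
  vector belongs to a basis.
\<close>

lemma filtr_top_zero:
  assumes p: "1 \<le> p"
  shows "filtr br k p (int m) \<subseteq> {0}"
proof -
  have "filtr br k 1 (int m) \<subseteq> {0}"
  proof (cases "2 \<le> k")
    case True
    obtain w where w: "w \<in> descending_series br (k - 1)" "w \<noteq> 0"
      using step subspace_0[OF subspace_descending_series] by (auto simp: step_nilpotent_def)
    have single: "distinct [w]" "independent (set [w])" "set [w] \<subseteq> UNIV"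
      using w(2) by (auto simp: dependent_single)
    obtain bs where bs: "distinct (bs @ [w])" "independent (set (bs @ [w]))"
        "span (set (bs @ [w])) = UNIV" "set bs \<subseteq> UNIV"
      by (rule basis_list_extending[OF finite_dimensional subspace_UNIV single])
    have len: "length (bs @ [w]) = m" by (rule basis_length[OF bs(1-3)])
    have "f us = 0" if f: "f \<in> forms_killing (int m) (descending_series br (k - 1))" for f us
    proof (cases "length us = m")
      case True
      show ?thesis
      proof (rule alternating_form_top_eq_0[of f "{}" "bs @ [w]"])
        show "f (bs @ [w]) = 0" using f w(1) by (auto simp: forms_killing_def)
      qed (use f bs(3) len True in \<open>auto simp: forms_killing_def\<close>)
    next
      case False
      then show ?thesis using f by (simp add: forms_killing_def)
    qed
    moreover have "filtr br k 1 (int m) = forms_killing (int m) (descending_series br (k - 1))"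
      using True by (simp add: filtr_eq nat_diff_distrib)
    ultimately show ?thesis by (auto simp: fun_eq_iff)
  next
    case False
    then show ?thesis by (simp add: filtr_eq)
  qed
  then show ?thesis using filtr_antimono[OF p] by blast
qed

lemma cohomology_top: "vs_isomorphic (cohomology br (int m)) (vs_of (UNIV :: real set))"
proof -
  obtain es where es: "distinct es" "independent (set es)" "span (set es) = UNIV" "flag es"
    by (rule flag_basis_exists)
  have len: "length es = m" by (rule basis_length[OF es(1-3)])
  obtain vol where vol: "alternating_form vol" "\<And>us. length us \<noteq> length es \<Longrightarrow> vol us = 0" "vol es = 1"
    using top_form_exists[OF es(1-3)] by metis
  have "ce_diff br f = 0" if "f \<in> cochains (int m)" for f
    by (rule cochains_above_top[OF ce_diff_cochains[OF that]]) simp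
  then have Z: "cocycles br (int m) = cochains (int m)" by (auto simp: cocycles_def)
  have vol_coch: "c *\<^sub>R vol \<in> cochains (int m)" for c
    using vol len by (auto simp: cochains_iff alternating_form_scaleR)
  have det: "f = f es *\<^sub>R vol" if f: "f \<in> cochains (int m)" for f
  proof
    fix us
    let ?g = "f + (- f es) *\<^sub>R vol"
    have "?g us = 0"
    proof (cases "length us = m")
      case True
      show ?thesis
      proof (rule alternating_form_top_eq_0[of ?g "{}" es])
        show "alternating_form ?g"
          using f vol(1) by (intro alternating_form_add alternating_form_scaleR) (simp add: cochains_iff)
      qed (use vol(3) es(3) len True in auto)
    next
      case False
      then show ?thesis using f vol(2)[of us] len by (simp add: cochains_iff)
    qed
    then show "f us = (f es *\<^sub>R vol) us" by simp
  qed
  have "bij_betw (\<lambda>f. f es) (cocycles br (int m)) (UNIV :: real set)"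
    unfolding Z using vol_coch det vol(3)
    by (intro bij_betwI[where g = "\<lambda>c. c *\<^sub>R vol"]) auto
  then show ?thesis
    unfolding cohomology_def coboundaries_top by (rule vs_quot_zero_isomorphic) simp_all
qed

end

section \<open>The limit terms in degrees 0, 1, m - 1 and m\<close>

theorem theorem3p2:
  fixes br :: "'n::real_vector \<Rightarrow> 'n \<Rightarrow> 'n" and m k :: nat
  assumes "real_lie_algebra br"
    and "dim (UNIV :: 'n set) = m"
    and "step_nilpotent br k"
  shows
    "(limit_eq_cohomology br k (int k - 1) (1 - int k) \<and>
     vs_iso (vs_of (UNIV :: real set)) (cohomology br 0)
       (\<lambda>c. cohomology_class br 0 (c *\<^sub>R wedge [])) \<and>
     (\<forall>p \<in> {0..int k - 2}. vs_is_zero (ss_E_inf br k p (- p)))) \<and>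
     (limit_eq_cohomology br k (int k - 1) (2 - int k) \<and>
     vs_iso (vs_of (ker_d br)) (cohomology br 1)
       (\<lambda>x. cohomology_class br 1 (wedge [x])) \<and>
     (\<forall>p \<in> {0..int k - 2}. vs_is_zero (ss_E_inf br k p (1 - p)))) \<and>
     (limit_eq_cohomology br k 0 (int m - 1) \<and>
     (\<forall>p \<in> {1..int k - 1}. vs_is_zero (ss_E_inf br k p (int m - 1 - p)))) \<and>
     (vs_isomorphic (ss_E_inf br k 0 (int m)) (cohomology br (int m)) \<and>
     vs_isomorphic (cohomology br (int m)) (vs_of (UNIV :: real set)) \<and>
     (\<forall>p \<in> {1..int k - 1}. vs_is_zero (ss_E_inf br k p (int m - p))))"
proof -
  interpret nilpotent_lie_algebra br k m
    using assms by (simp add: nilpotent_lie_algebra_def nilpotent_lie_algebra_axioms_def)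
  have F_k: "cocycles br n \<inter> filtr br k (int k - 1 + 1) n \<subseteq> coboundaries br n" for n
    using subspace_0[OF subspace_coboundaries] by (auto simp: filtr_eq)
  note zero_filtr = subspace_0[OF subspace_filtr]
  have deg0: "limit_eq_cohomology br k (int k - 1) (1 - int k)"
    by (rule limit_term_eq_cohomology(2)[of _ _ 0, OF _ cocycles_0_filtr F_k])
      (simp_all add: coboundaries_0 zero_filtr)
  have deg0': "vs_is_zero (ss_E_inf br k p (- p))" if "p \<in> {0..int k - 2}" for p
    using cocycles_0_filtr filtr_antimono[of "p + 1" "int k - 1" 0] that
    by (intro ss_E_inf_is_zero_if_cocycles_deeper[of _ _ 0]) auto
  have deg1: "limit_eq_cohomology br k (int k - 1) (2 - int k)"
    by (rule limit_term_eq_cohomology(2)[of _ _ 1, OF _ _ F_k])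
      (auto simp: coboundaries_1 zero_filtr intro: closed_1_form(1))
  have deg1': "vs_is_zero (ss_E_inf br k p (1 - p))" if "p \<in> {0..int k - 2}" for p
    using closed_1_form(1) filtr_antimono[of "p + 1" "int k - 1" 1] that
    by (intro ss_E_inf_is_zero_if_cocycles_deeper[of _ _ 1]) auto
  have F_0: "cocycles br n \<subseteq> filtr br k 0 n" "coboundaries br n \<subseteq> filtr br k 0 n" for n
    using coboundaries_cochains by (auto simp: filtr_nonpos cocycles_def)
  have deg_m1: "limit_eq_cohomology br k 0 (int m - 1)"
    using filtr_below_top_exact[of 1]
    by (intro limit_term_eq_cohomology(2)[of _ _ "int m - 1"] F_0) auto
  have deg_m1': "vs_is_zero (ss_E_inf br k p (int m - 1 - p))" if "p \<in> {1..int k - 1}" for p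
    using filtr_below_top_exact[of p] that
    by (intro ss_E_inf_is_zero_if_exact[of _ _ "int m - 1"]) auto
  have "ss_E_inf br k 0 (int m) = cohomology br (int m)"
    using filtr_top_zero[of 1]
    by (intro limit_term_eq_cohomology(1)[of _ _ "int m"] F_0) (auto simp: coboundaries_top)
  then have deg_m: "vs_isomorphic (ss_E_inf br k 0 (int m)) (cohomology br (int m))"
    using vs_iso_refl by (auto simp: vs_isomorphic_def)
  have deg_m': "vs_is_zero (ss_E_inf br k p (int m - p))" if "p \<in> {1..int k - 1}" for p
    using filtr_top_zero[of p] that
    by (intro ss_E_inf_is_zero_if_exact[of _ _ "int m"]) (auto simp: coboundaries_top)
  show ?thesis
    using deg0 deg0' cohomology_0_iso deg1 deg1' cohomology_1_iso deg_m1 deg_m1' deg_m cohomology_top deg_m'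
    by blast
qed

end
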